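(* Let $\mathbbm M=\mathcal G^*/R$ be an effective group with generating set $\mathcal G$. Let $X\subseteq\mathcal A^{\mathbbm M}$ be a subshift and $Y\subseteq\mathcal B^{\mathbbm M}$ a subshift, and let $\mathcal B'\subseteq\mathcal B$ with $|\mathcal B'|\ge 5$ be such that $Y$ is $\alpha_{abc}$-permutable for all $a,b,c\in\mathcal B'$. Let $H$ be the subgroup of automorphisms of $X\times Y$ generated by the maps $\sigma^g_1$ for $g\in\mathcal G$ and $C_{u_0,\alpha_{abc}}$ for $a,b,c\in\mathcal B'$ and $u_0\in\mathcal A$. Then the colanguage $\complement\mathcal L(X)$ is one-one-reducible to the word problem of $H$ with respect to this generating set.
   Context: $\mathcal G\subseteq\mathbb N$, $\mathcal G^*$ the free monoid, $R$ a monoid congruence, $\pi:\mathcal G^*\to\mathbbm M$ the quotient; effective group: there is a computable $\psi:\mathcal G^*\to\mathcal G^*$ with $\pi(i\psi(i))=\pi(\psi(i)i)=1$. $\mathcal A,\mathcal B$ are finite alphabets with at least two letters. Shift action: $\sigma^i(x)_j=x_{ij}$; a subshift is a closed shift-invariant subset of $\mathcal A^{\mathbbm M}$. A pattern is $u\in\mathcal A^{W}$ with $W\subseteq\mathcal G^*$ finite; the cylinder $[u]$ is the set of $x$ with $x_{\pi(i)}=u_i$ for all $i\in W$; a letter $u_0\in\mathcal A$ is regarded as the pattern with support $\{\lambda\}$ ($\lambda$ the empty word). The language $\mathcal L(X)$ is the set of patterns $u$ with $[u]\cap X\neq\emptyset$; the colanguage $\complement\mathcal L(X)$ is the set of all other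 patterns. For $a,b,c\in\mathcal B$, $\alpha_{abc}:\mathcal B\to\mathcal B$ is the 3-cycle $a\mapsto b\mapsto c\mapsto a$ fixing all other letters. $Y$ is $\alpha$-permutable if for every $y\in Y$, the configuration $z$ with $z_1=\alpha(y_1)$ (at the identity $1$) and $z_i=y_i$ for $i\neq 1$ lies in $Y$. The controlled map $C_{u,\alpha}$ is the shift-commuting map on $X\times Y$ given at the identity by $C_{u,\alpha}(x,y)_1=(x_1,\alpha(y_1))$ if $x\in[u]$ and $(x_1,y_1)$ otherwise (hence at position $g$ it applies $\alpha$ to $y_g$ iff $\sigma^g(x)\in[u]$). $\sigma^g_1$ denotes the shift of the first component: $\sigma^g_1(x,y)=(\sigma^g(x),y)$. The word problem of $H$ with respect to a generating set $S$ is the set of finite words over $S$ whose product is the identity map. $P$ is one-one-reducible to $Q$ if there is a computable injective $\phi$ with $x\in P\iff\phi(x)\in Q$.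
   Formalization: The formal theorem additionally assumes that some letter of B' occurs in Y (otherwise all controlled maps may be trivial and the claim is false) and that each σ^g_1 is indeed a shift-commuting automorphism of X×Y (automatic for abelian groups, not for general ones). *)

theory Defs
  imports
    "HOL-Analysis.Function_Topology"
    "HOL-Analysis.Product_Topology"
    "HOL-Algebra.Elementary_Groups"
    "HOL-Algebra.Bij"
    "HOL-Library.Nat_Bijection"
    "HOL-Library.Countable"
begin

section \<open>Computability\<close>

definition minimize :: "(nat \<Rightarrow> nat option) \<Rightarrow> nat option" where
  "minimize f =
     (if \<exists>k. f k = Some 0 \<and> (\<forall>j<k. \<exists>v. f j = Some (Suc v))
      then Some (LEAST k. f k = Some 0) else None)"

text \<open>
  Kleene's partial recursive functions of arity \<open>n\<close>.  A function is given on argument lists and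
  only its values on lists of length \<open>n\<close> are meaningful; \<open>None\<close> stands for divergence.
\<close>

inductive partial_recursive :: "nat \<Rightarrow> (nat list \<Rightarrow> nat option) \<Rightarrow> bool" where
  zero: "partial_recursive n (\<lambda>xs. Some 0)"
| succ: "partial_recursive 1 (\<lambda>xs. Some (Suc (hd xs)))"
| proj: "i < n \<Longrightarrow> partial_recursive n (\<lambda>xs. Some (xs ! i))"
| comp: "partial_recursive (length gs) f \<Longrightarrow> \<forall>g\<in>set gs. partial_recursive n g \<Longrightarrow>
    partial_recursive n (\<lambda>xs. Option.bind (those (map (\<lambda>g. g xs) gs)) f)"
| prim_rec: "partial_recursive n f \<Longrightarrow> partial_recursive (Suc (Suc n)) g \<Longrightarrow>
    partial_recursive (Suc n)
      (\<lambda>xs. rec_nat (f (tl xs)) (\<lambda>k r. Option.bind r (\<lambda>v. g (k # v # tl xs))) (hd xs))"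
| minim: "partial_recursive (Suc n) f \<Longrightarrow> partial_recursive n (\<lambda>xs. minimize (\<lambda>k. f (k # xs)))"

text \<open>
  A map \<open>f\<close> on a set \<open>D\<close> of objects coded by \<open>cx\<close>, with values coded by \<open>cy\<close>, is computable if an
  algorithm halts with output \<open>f x\<close> on every input \<open>x \<in> D\<close>.  Nothing is required on numbers that
  are not codes of elements of \<open>D\<close>: the set \<open>D\<close> need not be decidable, since the set of
  generators of the monoid is an arbitrary set of natural numbers.
\<close>

definition computable_on :: "('x \<Rightarrow> nat) \<Rightarrow> ('y \<Rightarrow> nat) \<Rightarrow> 'x set \<Rightarrow> ('x \<Rightarrow> 'y) \<Rightarrow> bool" where
  "computable_on cx cy D f \<longleftrightarrow>
     (\<exists>F. partial_recursive 1 F \<and> (\<forall>x\<in>D. F [cx x] = Some (cy (f x))))"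

text \<open>\<open>P\<close> and \<open>Q\<close> are regarded as decision problems with instances in \<open>D\<close> and \<open>E\<close> respectively.\<close>

definition one_one_reducible ::
    "('x \<Rightarrow> nat) \<Rightarrow> 'x set \<Rightarrow> 'x set \<Rightarrow> ('y \<Rightarrow> nat) \<Rightarrow> 'y set \<Rightarrow> 'y set \<Rightarrow> bool" where
  "one_one_reducible cx D P cy E Q \<longleftrightarrow>
     (\<exists>\<phi>. computable_on cx cy D \<phi> \<and> \<phi> \<in> D \<rightarrow> E \<and> inj_on \<phi> D \<and> (\<forall>x\<in>D. x \<in> P \<longleftrightarrow> \<phi> x \<in> Q))"


section \<open>Quotients of free monoids\<close>

definition monoid_congruence :: "nat set \<Rightarrow> nat list rel \<Rightarrow> bool" where
  "monoid_congruence G R \<longleftrightarrow> equiv (lists G) R \<and>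
     (\<forall>u u' v v'. (u, u') \<in> R \<longrightarrow> (v, v') \<in> R \<longrightarrow> (u @ v, u' @ v') \<in> R)"

definition quotient_monoid :: "nat set \<Rightarrow> nat list rel \<Rightarrow> nat list set monoid" where
  "quotient_monoid G R =
     \<lparr>carrier = lists G // R,
      mult = \<lambda>p q. \<Union>u\<in>p. \<Union>v\<in>q. R `` {u @ v},
      one = R `` {[]}\<rparr>"

definition proj_word :: "nat list rel \<Rightarrow> nat list \<Rightarrow> nat list set" where
  "proj_word R w = R `` {w}"

definition effective_group :: "nat set \<Rightarrow> nat list rel \<Rightarrow> bool" where
  "effective_group G R \<longleftrightarrow>
     (\<exists>\<psi>. computable_on list_encode list_encode (lists G) \<psi> \<and>
       (\<forall>w\<in>lists G. \<psi> w \<in> lists G \<and>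
          proj_word R (w @ \<psi> w) = \<one>\<^bsub>quotient_monoid G R\<^esub> \<and>
          proj_word R (\<psi> w @ w) = \<one>\<^bsub>quotient_monoid G R\<^esub>))"


section \<open>Subshifts\<close>

text \<open>
  The alphabet is the whole finite letter type.  Configurations over a monoid \<open>M\<close> are functions
  that are extensional on the carrier of \<open>M\<close>.
\<close>

definition config_topology :: "('m, 'k) monoid_scheme \<Rightarrow> ('m \<Rightarrow> 'a) topology" where
  "config_topology M = product_topology (\<lambda>_. discrete_topology UNIV) (carrier M)"

definition shift :: "('m, 'k) monoid_scheme \<Rightarrow> 'm \<Rightarrow> ('m \<Rightarrow> 'a) \<Rightarrow> 'm \<Rightarrow> 'a" where
  "shift M i x = (\<lambda>j\<in>carrier M. x (i \<otimes>\<^bsub>M\<^esub> j))"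

definition subshift :: "('m, 'k) monoid_scheme \<Rightarrow> ('m \<Rightarrow> 'a::finite) set \<Rightarrow> bool" where
  "subshift M X \<longleftrightarrow>
     closedin (config_topology M) X \<and> (\<forall>i\<in>carrier M. \<forall>x\<in>X. shift M i x \<in> X)"

definition permutable ::
    "('m, 'k) monoid_scheme \<Rightarrow> ('b \<Rightarrow> 'b) \<Rightarrow> ('m \<Rightarrow> 'b) set \<Rightarrow> bool" where
  "permutable M \<alpha> Y \<longleftrightarrow> (\<forall>y\<in>Y. y(\<one>\<^bsub>M\<^esub> := \<alpha> (y \<one>\<^bsub>M\<^esub>)) \<in> Y)"

text \<open>
  A pattern is a finite partial map on words; its support is its domain.  Distinct words of the
  support may represent the same element of the monoid.
\<close>

type_synonym 'a pattern = "nat list \<rightharpoonup> 'a"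

definition patterns :: "nat set \<Rightarrow> 'a pattern set" where
  "patterns G = {u. finite (dom u) \<and> dom u \<subseteq> lists G}"

definition cylinder :: "nat set \<Rightarrow> nat list rel \<Rightarrow> 'a pattern \<Rightarrow> (nat list set \<Rightarrow> 'a) set" where
  "cylinder G R u =
     {x \<in> carrier (quotient_monoid G R) \<rightarrow>\<^sub>E UNIV. \<forall>w\<in>dom u. x (proj_word R w) = the (u w)}"

definition language ::
    "nat set \<Rightarrow> nat list rel \<Rightarrow> (nat list set \<Rightarrow> 'a) set \<Rightarrow> 'a pattern set" where
  "language G R X = {u \<in> patterns G. cylinder G R u \<inter> X \<noteq> {}}"

definition colanguage ::
    "nat set \<Rightarrow> nat list rel \<Rightarrow> (nat list set \<Rightarrow> 'a) set \<Rightarrow> 'a pattern set" where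
  "colanguage G R X = patterns G - language G R X"


section \<open>Automorphisms of a product of subshifts\<close>

definition automorphism_group ::
    "('m, 'k) monoid_scheme \<Rightarrow> ('m \<Rightarrow> 'a) set \<Rightarrow> ('m \<Rightarrow> 'b) set \<Rightarrow>
     (('m \<Rightarrow> 'a) \<times> ('m \<Rightarrow> 'b) \<Rightarrow> ('m \<Rightarrow> 'a) \<times> ('m \<Rightarrow> 'b)) monoid" where
  "automorphism_group M X Y =
     (let T = subtopology (prod_topology (config_topology M) (config_topology M)) (X \<times> Y) in
      BijGroup (X \<times> Y)
        \<lparr>carrier := {f \<in> Bij (X \<times> Y).
           homeomorphic_map T T f \<and>
           (\<forall>h\<in>carrier M. \<forall>p\<in>X \<times> Y.
              f (map_prod (shift M h) (shift M h) p) = map_prod (shift M h) (shift M h) (f p))}\<rparr>)"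

definition shift_fst ::
    "('m, 'k) monoid_scheme \<Rightarrow> ('m \<Rightarrow> 'a) set \<Rightarrow> ('m \<Rightarrow> 'b) set \<Rightarrow> 'm \<Rightarrow>
     ('m \<Rightarrow> 'a) \<times> ('m \<Rightarrow> 'b) \<Rightarrow> ('m \<Rightarrow> 'a) \<times> ('m \<Rightarrow> 'b)" where
  "shift_fst M X Y g = (\<lambda>(x, y)\<in>X \<times> Y. (shift M g x, y))"

definition three_cycle :: "'b \<Rightarrow> 'b \<Rightarrow> 'b \<Rightarrow> 'b \<Rightarrow> 'b" where
  "three_cycle a b c = id(a := b, b := c, c := a)"

definition controlled ::
    "nat set \<Rightarrow> nat list rel \<Rightarrow> (nat list set \<Rightarrow> 'a) set \<Rightarrow> (nat list set \<Rightarrow> 'b) set \<Rightarrow>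
     'a pattern \<Rightarrow> ('b \<Rightarrow> 'b) \<Rightarrow>
     (nat list set \<Rightarrow> 'a) \<times> (nat list set \<Rightarrow> 'b) \<Rightarrow> (nat list set \<Rightarrow> 'a) \<times> (nat list set \<Rightarrow> 'b)" where
  "controlled G R X Y u \<alpha> =
     (\<lambda>(x, y)\<in>X \<times> Y.
        (x, \<lambda>g\<in>carrier (quotient_monoid G R).
              if shift (quotient_monoid G R) g x \<in> cylinder G R u then \<alpha> (y g) else y g))"


section \<open>The group and its word problem\<close>

text \<open>
  Names of the generators, so that words over the generators can be coded by natural numbers.
  Different names may denote the same map.
\<close>

datatype ('a, 'b) generator = Shift nat | Control 'a 'b 'b 'b

definition generators :: "nat set \<Rightarrow> 'b set \<Rightarrow> ('a, 'b) generator set" where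
  "generators G B' = Shift ` G \<union>
     {Control u0 a b c | u0 a b c. a \<in> B' \<and> b \<in> B' \<and> c \<in> B' \<and> distinct [a, b, c]}"

fun generator_map ::
    "nat set \<Rightarrow> nat list rel \<Rightarrow> (nat list set \<Rightarrow> 'a) set \<Rightarrow> (nat list set \<Rightarrow> 'b) set \<Rightarrow>
     ('a, 'b) generator \<Rightarrow>
     (nat list set \<Rightarrow> 'a) \<times> (nat list set \<Rightarrow> 'b) \<Rightarrow> (nat list set \<Rightarrow> 'a) \<times> (nat list set \<Rightarrow> 'b)" where
  "generator_map G R X Y (Shift g) = shift_fst (quotient_monoid G R) X Y (proj_word R [g])"
| "generator_map G R X Y (Control u0 a b c) = controlled G R X Y [[] \<mapsto> u0] (three_cycle a b c)"

text \<open>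
  Note that \<open>subgroup_generated\<close> discards those members of the second argument that are outside
  the ambient group.  For a nonabelian monoid, \<open>shift_fst\<close> need not commute with the diagonal shift;
  that it does is a condition on \<open>X\<close>, to be required where \<open>generated_group\<close> is used.
\<close>

definition generated_group ::
    "nat set \<Rightarrow> nat list rel \<Rightarrow> (nat list set \<Rightarrow> 'a) set \<Rightarrow> (nat list set \<Rightarrow> 'b) set \<Rightarrow> 'b set \<Rightarrow>
     ((nat list set \<Rightarrow> 'a) \<times> (nat list set \<Rightarrow> 'b) \<Rightarrow> (nat list set \<Rightarrow> 'a) \<times> (nat list set \<Rightarrow> 'b)) monoid"
  where
  "generated_group G R X Y B' =
     subgroup_generated (automorphism_group (quotient_monoid G R) X Y)
       (generator_map G R X Y ` generators G B')"

definition word_problem :: "('g, 'k) monoid_scheme \<Rightarrow> 's set \<Rightarrow> ('s \<Rightarrow> 'g) \<Rightarrow> 's list set" where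
  "word_problem H S val =
     {w \<in> lists S. foldr (\<otimes>\<^bsub>H\<^esub>) (map val w) \<one>\<^bsub>H\<^esub> = \<one>\<^bsub>H\<^esub>}"


section \<open>Codings\<close>

text \<open>
  Letters are numbered by \<open>to_nat\<close>; the alphabets being finite, any other injective numbering
  gives the same notion of computability.
\<close>

definition pattern_code :: "('a::finite) pattern \<Rightarrow> nat" where
  "pattern_code u =
     set_encode ((\<lambda>(w, a). prod_encode (list_encode w, to_nat a)) ` Map.graph u)"

fun generator_code :: "('a::finite, 'b::finite) generator \<Rightarrow> nat" where
  "generator_code (Shift g) = sum_encode (Inl g)"
| "generator_code (Control u0 a b c) =
     sum_encode (Inr (list_encode [to_nat u0, to_nat a, to_nat b, to_nat c]))"

definition generator_word_code :: "('a::finite, 'b::finite) generator list \<Rightarrow> nat" where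
  "generator_word_code w = list_encode (map generator_code w)"

end

theory Submission
  imports Defs
begin

text \<open>
  For five letters \<open>p, q, r, s, t\<close> let \<open>\<gamma> = (p q r)\<close> and \<open>\<beta> = (p q)(s t)\<close>, a product of two 3-cycles.
  Then \<open>\<beta> \<gamma> \<beta> = \<gamma>\<^sup>-\<^sup>1\<close>, so the commutator of \<open>\<beta>\<close> and \<open>\<gamma>\<close> is \<open>\<gamma>\<^sup>-\<^sup>2 = \<gamma>\<close>.  Hence the commutator of
  \<open>\<beta>\<close> controlled by a condition \<open>P\<close> and \<open>\<gamma>\<close> controlled by \<open>Q\<close> is \<open>\<gamma>\<close> controlled by \<open>P \<and> Q\<close>.  The
  condition \<open>x\<^bsub>\<pi>(w)\<^esub> = a\<close> on a single cell is obtained by conjugating a generator with the shift by \<open>w\<close>,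
  the inverse shift being the one by \<open>\<psi>(w)\<close>.  Iterating over the cells of a pattern \<open>u\<close> gives a word
  for \<open>\<gamma>\<close> controlled by \<open>u\<close>, which is the identity iff \<open>[u]\<close> does not meet \<open>X\<close>.
\<close>

section \<open>Recursive functions on codes\<close>

text \<open>Values are prescribed only on lists of length \<open>n\<close>, the only ones on which a
  function of arity \<open>n\<close> is meaningful. The \<open>option\<close> type can then be left
  aside until the possibly diverging algorithm for \<open>\<psi>\<close> enters.\<close>

definition total_recursive :: "nat \<Rightarrow> (nat list \<Rightarrow> nat) \<Rightarrow> bool" where
  "total_recursive n f \<longleftrightarrow>
     (\<exists>F. partial_recursive n F \<and> (\<forall>xs. length xs = n \<longrightarrow> F xs = Some (f xs)))"

lemma total_recursive_cong:
  assumes "total_recursive n f" "\<And>xs. length xs = n \<Longrightarrow> f xs = g xs"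
  shows "total_recursive n g"
  using assms unfolding total_recursive_def by metis

lemma those_map_Some:
  "(\<And>x. x \<in> set l \<Longrightarrow> f x = Some (g x)) \<Longrightarrow> those (map f l) = Some (map g l)"
  by (induction l) auto

lemma total_recursive_comp:
  assumes g: "total_recursive (length fs) g" and fs: "\<And>f. f \<in> set fs \<Longrightarrow> total_recursive n f"
  shows "total_recursive n (\<lambda>xs. g (map (\<lambda>f. f xs) fs))"
proof -
  obtain F where F: "partial_recursive (length fs) F"
      "\<And>xs. length xs = length fs \<Longrightarrow> F xs = Some (g xs)"
    using g unfolding total_recursive_def by blast
  have "\<forall>f\<in>set fs. \<exists>F. partial_recursive n F \<and> (\<forall>xs. length xs = n \<longrightarrow> F xs = Some (f xs))"
    using fs unfolding total_recursive_def by blast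
  then obtain c where c: "\<And>f. f \<in> set fs \<Longrightarrow> partial_recursive n (c f)"
      "\<And>f xs. f \<in> set fs \<Longrightarrow> length xs = n \<Longrightarrow> c f xs = Some (f xs)"
    by metis
  have "partial_recursive n (\<lambda>xs. Option.bind (those (map (\<lambda>g. g xs) (map c fs))) F)"
    by (rule partial_recursive.comp) (use F c in auto)
  moreover have "Option.bind (those (map (\<lambda>g. g xs) (map c fs))) F = Some (g (map (\<lambda>f. f xs) fs))"
    if "length xs = n" for xs
  proof -
    have "those (map (\<lambda>f. c f xs) fs) = Some (map (\<lambda>f. f xs) fs)"
      by (rule those_map_Some) (use c that in auto)
    then show ?thesis
      using F(2) by (simp add: comp_def)
  qed
  ultimately show ?thesis
    unfolding total_recursive_def by blast
qed

lemma total_recursive_comp1: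
  assumes "total_recursive 1 (\<lambda>xs. g (xs ! 0))" "total_recursive n f"
  shows "total_recursive n (\<lambda>xs. g (f xs))"
  using total_recursive_comp[of "[f]" "\<lambda>xs. g (xs ! 0)" n] assms by simp

lemma total_recursive_nth: "i < n \<Longrightarrow> total_recursive n (\<lambda>xs. xs ! i)"
  unfolding total_recursive_def using partial_recursive.proj by blast

lemma total_recursive_nth_drop: "k + i < n \<Longrightarrow> total_recursive n (\<lambda>xs. drop k xs ! i)"
  by (rule total_recursive_cong[OF total_recursive_nth[of "k + i"]]) auto

lemma total_recursive_Suc:
  assumes "total_recursive n f"
  shows "total_recursive n (\<lambda>xs. Suc (f xs))"
proof (rule total_recursive_comp1[OF _ assms])
  show "total_recursive 1 (\<lambda>xs. Suc (xs ! 0))"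
    unfolding total_recursive_def using partial_recursive.succ
    by (metis One_nat_def hd_conv_nth list.size(3) zero_neq_one)
qed

lemma total_recursive_const: "total_recursive n (\<lambda>xs. c)"
proof (induction c)
  case 0
  then show ?case
    unfolding total_recursive_def using partial_recursive.zero by blast
qed (rule total_recursive_Suc)

lemma total_recursive_prim_rec:
  assumes b: "total_recursive n b" and s: "total_recursive (Suc (Suc n)) s"
  shows "total_recursive (Suc n) (\<lambda>xs. rec_nat (b (tl xs)) (\<lambda>k r. s (k # r # tl xs)) (hd xs))"
proof -
  obtain B S where B: "partial_recursive n B" "\<And>xs. length xs = n \<Longrightarrow> B xs = Some (b xs)"
    and S: "partial_recursive (Suc (Suc n)) S"
      "\<And>xs. length xs = Suc (Suc n) \<Longrightarrow> S xs = Some (s xs)"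
    using b s unfolding total_recursive_def by blast
  have "rec_nat (B (tl xs)) (\<lambda>k r. Option.bind r (\<lambda>v. S (k # v # tl xs))) m =
      Some (rec_nat (b (tl xs)) (\<lambda>k r. s (k # r # tl xs)) m)" if "length xs = Suc n" for xs m
    by (induction m) (use B S that in auto)
  with partial_recursive.prim_rec[OF B(1) S(1)] show ?thesis
    unfolding total_recursive_def by blast
qed

lemma total_recursive_rec:
  assumes c: "total_recursive n c" and b: "total_recursive n b"
    and s: "total_recursive (Suc (Suc n)) (\<lambda>ys. s (ys ! 0) (ys ! 1) (drop 2 ys))"
  shows "total_recursive n (\<lambda>xs. rec_nat (b xs) (\<lambda>k r. s k r xs) (c xs))"
proof -
  let ?fs = "c # map (\<lambda>i xs. xs ! i) [0..<n]"
  have "total_recursive n (\<lambda>xs. (\<lambda>xs. rec_nat (b (tl xs))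
      (\<lambda>k r. (\<lambda>ys. s (ys ! 0) (ys ! 1) (drop 2 ys)) (k # r # tl xs)) (hd xs)) (map (\<lambda>f. f xs) ?fs))"
    by (rule total_recursive_comp)
       (use total_recursive_prim_rec[OF b s] c in \<open>auto intro: total_recursive_nth\<close>)
  then show ?thesis
  proof (rule total_recursive_cong)
    fix xs :: "nat list"
    assume "length xs = n"
    then have "map (\<lambda>f. f xs) ?fs = c xs # xs"
      by (simp add: comp_def) (metis map_nth)
    then show "(\<lambda>xs. rec_nat (b (tl xs))
      (\<lambda>k r. (\<lambda>ys. s (ys ! 0) (ys ! 1) (drop 2 ys)) (k # r # tl xs)) (hd xs)) (map (\<lambda>f. f xs) ?fs)
      = rec_nat (b xs) (\<lambda>k r. s k r xs) (c xs)"
      by (simp add: numeral_2_eq_2)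
  qed
qed

lemma total_recursive_funpow:
  assumes "total_recursive 1 (\<lambda>xs. f (xs ! 0))" "total_recursive n c" "total_recursive n b"
  shows "total_recursive n (\<lambda>xs. (f ^^ c xs) (b xs))"
proof -
  have "rec_nat x (\<lambda>k. f) m = (f ^^ m) x" for m x
    by (induction m) auto
  moreover have "total_recursive n (\<lambda>xs. rec_nat (b xs) (\<lambda>k r. f r) (c xs))"
    by (intro total_recursive_rec assms total_recursive_comp1[OF assms(1)] total_recursive_nth) simp
  ultimately show ?thesis
    by simp
qed

section \<open>Arithmetic and case distinctions\<close>

lemma total_recursive_add:
  assumes "total_recursive n f" "total_recursive n g"
  shows "total_recursive n (\<lambda>xs. f xs + g xs)"
proof -
  have "total_recursive n (\<lambda>xs. (Suc ^^ f xs) (g xs))"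
    by (intro total_recursive_funpow total_recursive_Suc total_recursive_nth assms) simp
  then show ?thesis
    by (simp add: Suc_funpow)
qed

lemma total_recursive_pred:
  assumes "total_recursive n f"
  shows "total_recursive n (\<lambda>xs. f xs - 1)"
proof -
  have "rec_nat 0 (\<lambda>k r. k) m = m - 1" for m :: nat
    by (cases m) auto
  moreover have "total_recursive n (\<lambda>xs. rec_nat 0 (\<lambda>k r. k) (f xs))"
    by (intro total_recursive_rec total_recursive_const total_recursive_nth assms) simp
  ultimately show ?thesis
    by simp
qed

lemma total_recursive_diff:
  assumes "total_recursive n f" "total_recursive n g"
  shows "total_recursive n (\<lambda>xs. f xs - g xs)"
proof -
  have "((\<lambda>x. x - 1) ^^ m) x = x - m" for m x :: nat
    by (induction m) auto
  moreover have "total_recursive n (\<lambda>xs. ((\<lambda>x. x - 1) ^^ g xs) (f xs))"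
    by (intro total_recursive_funpow total_recursive_pred total_recursive_nth assms) simp
  ultimately show ?thesis
    by simp
qed

text \<open>A recursion whose step ignores both the counter and the previous value is a case
  distinction on whether the counter is zero.\<close>

lemma total_recursive_if_zero:
  assumes "total_recursive n c" "total_recursive n f" "total_recursive n g"
  shows "total_recursive n (\<lambda>xs. if c xs = 0 then f xs else g xs)"
proof -
  have "rec_nat x (\<lambda>k r. y) m = (if m = 0 then x else y)" for m x y :: nat
    by (cases m) auto
  moreover have "total_recursive (Suc (Suc n)) (\<lambda>ys. g (drop 2 ys))"
  proof -
    have "total_recursive (Suc (Suc n)) (\<lambda>ys. g (map (\<lambda>f. f ys) (map (\<lambda>i ys. drop 2 ys ! i) [0..<n])))"
      by (rule total_recursive_comp) (use assms in \<open>auto intro: total_recursive_nth_drop\<close>)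
    then show ?thesis
    proof (rule total_recursive_cong)
      fix ys :: "nat list"
      assume "length ys = Suc (Suc n)"
      then have "map (\<lambda>i. drop 2 ys ! i) [0..<n] = drop 2 ys"
        by (metis diff_Suc_Suc diff_zero length_drop map_nth numeral_2_eq_2)
      then show "g (map (\<lambda>f. f ys) (map (\<lambda>i ys. drop 2 ys ! i) [0..<n])) = g (drop 2 ys)"
        by (simp add: comp_def)
    qed
  qed
  then have "total_recursive n (\<lambda>xs. rec_nat (f xs) (\<lambda>k r. g xs) (c xs))"
    by (intro total_recursive_rec assms)
  ultimately show ?thesis
    by simp
qed

lemma total_recursive_if_le:
  assumes "total_recursive n f" "total_recursive n g" "total_recursive n p" "total_recursive n q"
  shows "total_recursive n (\<lambda>xs. if f xs \<le> g xs then p xs else q xs)"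
  using total_recursive_if_zero[OF total_recursive_diff[OF assms(1,2)] assms(3,4)] by simp

section \<open>Inverting the pairing function\<close>

lemma total_recursive_triangle:
  assumes "total_recursive n f"
  shows "total_recursive n (\<lambda>xs. triangle (f xs))"
proof -
  have "rec_nat 0 (\<lambda>k r. r + Suc k) m = triangle m" for m
    by (induction m) auto
  moreover have "total_recursive n (\<lambda>xs. rec_nat 0 (\<lambda>k r. r + Suc k) (f xs))"
    by (intro total_recursive_rec total_recursive_add total_recursive_Suc total_recursive_const
        total_recursive_nth assms) simp_all
  ultimately show ?thesis
    by simp
qed

lemma total_recursive_prod_encode:
  assumes "total_recursive n f" "total_recursive n g"
  shows "total_recursive n (\<lambda>xs. prod_encode (f xs, g xs))"
  unfolding prod_encode_def
  by (auto intro!: total_recursive_add total_recursive_triangle assms)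

text \<open>The largest \<open>m\<close> with \<open>triangle m \<le> z\<close>. It grows by at most
  one from \<open>z\<close> to \<open>Suc z\<close>, which makes it primitive recursive.\<close>

primrec triangle_root :: "nat \<Rightarrow> nat" where
  "triangle_root 0 = 0"
| "triangle_root (Suc z) =
     (if triangle (Suc (triangle_root z)) \<le> Suc z then Suc (triangle_root z) else triangle_root z)"

lemma triangle_root_bounds: "triangle (triangle_root z) \<le> z \<and> z < triangle (Suc (triangle_root z))"
  by (induction z) auto

lemma triangle_mono: "m \<le> n \<Longrightarrow> triangle m \<le> triangle n"
  by (induction rule: dec_induct) auto

text \<open>\<open>prod_encode (a, b)\<close> is \<open>triangle (a + b) + a\<close>, which lies
  below the next triangular number, so the root recovers the sum.\<close>

lemma triangle_root_prod_encode: "triangle_root (prod_encode (a, b)) = a + b"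
proof -
  define z where "z = prod_encode (a, b)"
  have z: "triangle (a + b) \<le> z" "z < triangle (Suc (a + b))"
    by (auto simp: z_def prod_encode_def)
  have "\<not> Suc (a + b) \<le> triangle_root z"
    using triangle_mono[of "Suc (a + b)" "triangle_root z"] z triangle_root_bounds[of z]
    by linarith
  moreover have "\<not> Suc (triangle_root z) \<le> a + b"
    using triangle_mono[of "Suc (triangle_root z)" "a + b"] z triangle_root_bounds[of z]
    by linarith
  ultimately show ?thesis
    by (simp add: z_def)
qed

text \<open>Once the sum \<open>a + b\<close> is known, subtraction yields \<open>a\<close> and then
  \<open>b\<close>; decoding is thus reduced to arithmetic and \<open>triangle_root\<close>.\<close>

lemma prod_decode_triangle_root:
  "fst (prod_decode z) = z - triangle (triangle_root z)"
  "snd (prod_decode z) = triangle_root z - (z - triangle (triangle_root z))"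
proof -
  obtain a b where "z = prod_encode (a, b)"
    by (metis prod_decode_inverse surj_pair)
  then show "fst (prod_decode z) = z - triangle (triangle_root z)"
    "snd (prod_decode z) = triangle_root z - (z - triangle (triangle_root z))"
    by (simp_all add: triangle_root_prod_encode) (simp_all add: prod_encode_def)
qed

lemma total_recursive_triangle_root:
  assumes "total_recursive n f"
  shows "total_recursive n (\<lambda>xs. triangle_root (f xs))"
proof -
  have "rec_nat 0 (\<lambda>k r. if triangle (Suc r) \<le> Suc k then Suc r else r) m = triangle_root m" for m
    by (induction m) simp_all
  moreover have "total_recursive n
      (\<lambda>xs. rec_nat 0 (\<lambda>k r. if triangle (Suc r) \<le> Suc k then Suc r else r) (f xs))"
    by (intro total_recursive_rec total_recursive_if_le total_recursive_triangle
        total_recursive_Suc total_recursive_const total_recursive_nth assms) simp_all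
  ultimately show ?thesis
    by simp
qed

lemma total_recursive_prod_decode:
  assumes "total_recursive n f"
  shows "total_recursive n (\<lambda>xs. fst (prod_decode (f xs)))"
    and "total_recursive n (\<lambda>xs. snd (prod_decode (f xs)))"
  unfolding prod_decode_triangle_root
  by (intro total_recursive_diff total_recursive_triangle total_recursive_triangle_root assms)+

section \<open>Mapping and concatenating coded lists\<close>

definition move_head :: "(nat \<Rightarrow> nat) \<Rightarrow> nat \<Rightarrow> nat" where
  "move_head h z =
     (if fst (prod_decode z) = 0 then z
      else prod_encode (snd (prod_decode (fst (prod_decode z) - 1)),
        Suc (prod_encode (h (fst (prod_decode (fst (prod_decode z) - 1))), snd (prod_decode z)))))"

text \<open>Each \<open>move_head\<close> takes the head off the first of two coded lists and puts
  its image on the second; a nonempty list has as code the successor of a pair, and the empty list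
  stops the movement. The code \<open>x\<close> bounds the length of its list, so \<open>x\<close>
  rounds are enough.\<close>

definition rev_map_onto :: "(nat \<Rightarrow> nat) \<Rightarrow> nat \<Rightarrow> nat \<Rightarrow> nat" where
  "rev_map_onto h x y = snd (prod_decode ((move_head h ^^ x) (prod_encode (x, y))))"

lemma length_le_list_encode: "length xs \<le> list_encode xs"
proof (induction xs)
  case (Cons x xs)
  then show ?case
    using le_prod_encode_2[of "list_encode xs" x] by simp
qed simp

lemma funpow_move_head:
  "length xs \<le> m \<Longrightarrow>
   (move_head h ^^ m) (prod_encode (list_encode xs, list_encode ys)) =
   prod_encode (0, list_encode (rev (map h xs) @ ys))"
proof (induction m arbitrary: xs ys)
  case (Suc m)
  have *: "(move_head h ^^ Suc m) z = (move_head h ^^ m) (move_head h z)" for z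
    by (simp add: funpow_swap1)
  show ?case
  proof (cases xs)
    case Nil
    then have "move_head h (prod_encode (list_encode xs, list_encode ys)) =
        prod_encode (list_encode xs, list_encode ys)"
      by (simp add: move_head_def)
    with Suc.IH[of "[]" ys] Nil show ?thesis
      unfolding * by simp
  next
    case (Cons a l)
    then have "move_head h (prod_encode (list_encode xs, list_encode ys)) =
        prod_encode (list_encode l, list_encode (h a # ys))"
      by (simp add: move_head_def)
    with Suc.IH[of l "h a # ys"] Suc.prems Cons show ?thesis
      unfolding * by simp
  qed
qed simp

lemma rev_map_onto:
  "rev_map_onto h (list_encode xs) (list_encode ys) = list_encode (rev (map h xs) @ ys)"
  unfolding rev_map_onto_def by (subst funpow_move_head[OF length_le_list_encode]) simp

lemma total_recursive_rev_map_onto: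
  assumes h: "total_recursive 1 (\<lambda>xs. h (xs ! 0))" and "total_recursive n f" "total_recursive n g"
  shows "total_recursive n (\<lambda>xs. rev_map_onto h (f xs) (g xs))"
  unfolding rev_map_onto_def move_head_def
  by (intro total_recursive_prod_decode total_recursive_funpow total_recursive_if_zero
      total_recursive_prod_encode total_recursive_Suc total_recursive_pred
      total_recursive_comp1[OF h] total_recursive_nth assms) simp_all

text \<open>Two reversals cancel: the mapped list is reversed onto the empty list, whose code is
  \<open>0\<close>, and then reversed again onto the second list.\<close>

lemma total_recursive_map_append:
  assumes "total_recursive 1 (\<lambda>xs. h (xs ! 0))" "total_recursive n f" "total_recursive n g"
  shows "total_recursive n (\<lambda>xs. list_encode (map h (list_decode (f xs)) @ list_decode (g xs)))"
proof -
  have "list_encode (map h (list_decode x) @ list_decode y) =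
      rev_map_onto (\<lambda>z. z) (rev_map_onto h x 0) y" for x y
    using rev_map_onto[of h "list_decode x" "[]"]
      rev_map_onto[of "\<lambda>z. z" "rev (map h (list_decode x))" "list_decode y"]
    by simp
  moreover have "total_recursive n (\<lambda>xs. rev_map_onto (\<lambda>z. z) (rev_map_onto h (f xs) 0) (g xs))"
    by (intro total_recursive_rev_map_onto total_recursive_nth total_recursive_const assms) simp
  ultimately show ?thesis
    by simp
qed

lemma total_recursive_append:
  assumes "total_recursive n f" "total_recursive n g"
  shows "total_recursive n (\<lambda>xs. list_encode (list_decode (f xs) @ list_decode (g xs)))"
  using total_recursive_map_append[of "\<lambda>z. z", OF total_recursive_nth assms] by simp

section \<open>Reading the bits of a number\<close>

lemma total_recursive_half:
  assumes "total_recursive n f"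
  shows "total_recursive n (\<lambda>xs. f xs div 2)"
proof -
  \<comment> \<open>The recursion works because \<open>m div 2\<close> and
    \<open>Suc m div 2\<close> add up to \<open>m\<close>.\<close>
  have "rec_nat 0 (\<lambda>k r. k - r) m = m div 2" for m :: nat
  proof (induction m)
    case (Suc m)
    have "m - m div 2 = Suc m div 2"
      by presburger
    with Suc show ?case
      by simp
  qed simp
  moreover have "total_recursive n (\<lambda>xs. rec_nat 0 (\<lambda>k r. k - r) (f xs))"
    by (intro total_recursive_rec total_recursive_diff total_recursive_const total_recursive_nth
        assms) simp_all
  ultimately show ?thesis
    by simp
qed

lemma total_recursive_mod_2:
  assumes "total_recursive n f"
  shows "total_recursive n (\<lambda>xs. f xs mod 2)"
proof -
  have "rec_nat 0 (\<lambda>k r. 1 - r) m = m mod 2" for m :: nat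
    by (induction m) (simp_all, presburger)
  moreover have "total_recursive n (\<lambda>xs. rec_nat 0 (\<lambda>k r. 1 - r) (f xs))"
    by (intro total_recursive_rec total_recursive_diff total_recursive_const total_recursive_nth
        assms) simp_all
  ultimately show ?thesis
    by simp
qed

lemma total_recursive_if_set_decode:
  assumes "total_recursive n f" "total_recursive n g" "total_recursive n p" "total_recursive n q"
  shows "total_recursive n (\<lambda>xs. if f xs \<in> set_decode (g xs) then p xs else q xs)"
proof -
  \<comment> \<open>Bit \<open>k\<close> is the parity after \<open>k\<close> halvings.\<close>
  have "((\<lambda>x. x div 2) ^^ k) m = m div 2 ^ k" for k m :: nat
    by (induction k) (simp_all add: div_mult2_eq power_Suc2 del: power_Suc)
  then have "k \<in> set_decode m \<longleftrightarrow> ((\<lambda>x. x div 2) ^^ k) m mod 2 \<noteq> 0" for k m :: nat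
    by (simp add: set_decode_def odd_iff_mod_2_eq_one)
  moreover have "total_recursive n
      (\<lambda>xs. if ((\<lambda>x. x div 2) ^^ f xs) (g xs) mod 2 = 0 then q xs else p xs)"
    by (intro total_recursive_if_zero total_recursive_mod_2 total_recursive_funpow
        total_recursive_half total_recursive_nth assms) simp
  ultimately show ?thesis
    by (smt (verit) total_recursive_cong)
qed

section \<open>The action of words over the generators\<close>

text \<open>The inverse is fixed as a function \<open>\<psi>\<close> on words, so that words over
  the generators can be built from \<open>\<psi> w\<close>. An automorphism commutes with the
  diagonal shift, and a point of \<open>Y\<close> is used to read this off on \<open>X\<close>
  alone.\<close>

locale controlled_product =
  fixes G :: "nat set" and R :: "nat list rel"
    and X :: "(nat list set \<Rightarrow> 'a::finite) set"
    and Y :: "(nat list set \<Rightarrow> 'b::finite) set"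
    and B' :: "'b set" and \<psi> :: "nat list \<Rightarrow> nat list"
  assumes congruence: "monoid_congruence G R"
    and inverse_word: "\<And>w. w \<in> lists G \<Longrightarrow> \<psi> w \<in> lists G \<and>
      proj_word R (w @ \<psi> w) = \<one>\<^bsub>quotient_monoid G R\<^esub> \<and>
      proj_word R (\<psi> w @ w) = \<one>\<^bsub>quotient_monoid G R\<^esub>"
    and subshift_X: "subshift (quotient_monoid G R) X"
    and subshift_Y: "subshift (quotient_monoid G R) Y"
    and cycles_permute: "\<And>a b c. a \<in> B' \<Longrightarrow> b \<in> B' \<Longrightarrow> c \<in> B' \<Longrightarrow> distinct [a, b, c] \<Longrightarrow>
      permutable (quotient_monoid G R) (three_cycle a b c) Y"
    and Y_nonempty: "Y \<noteq> {}"
    and shifts_are_automorphisms: "\<And>g. g \<in> G \<Longrightarrow>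
      shift_fst (quotient_monoid G R) X Y (proj_word R [g])
        \<in> carrier (automorphism_group (quotient_monoid G R) X Y)"
begin

abbreviation M where "M \<equiv> quotient_monoid G R"
abbreviation \<pi> where "\<pi> \<equiv> proj_word R"

section \<open>The quotient group and its shift action\<close>

lemma equiv_R: "equiv (lists G) R"
  using congruence by (simp add: monoid_congruence_def)

text \<open>The product of two classes is a union over representatives; by compatibility all members
  of this union are the same class.\<close>

lemma proj_word_mult:
  assumes "u \<in> lists G" "v \<in> lists G"
  shows "\<pi> u \<otimes>\<^bsub>M\<^esub> \<pi> v = \<pi> (u @ v)"
proof -
  have "R `` {u' @ v'} = R `` {u @ v}" if "u' \<in> R `` {u}" "v' \<in> R `` {v}" for u' v'
  proof -
    have "(u @ v, u' @ v') \<in> R"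
      using that congruence by (auto simp: monoid_congruence_def)
    then show ?thesis
      using equiv_class_eq[OF equiv_R] by metis
  qed
  moreover have "u \<in> R `` {u}" "v \<in> R `` {v}"
    using assms equiv_R by (auto simp: equiv_def refl_on_def)
  ultimately show ?thesis
    unfolding quotient_monoid_def proj_word_def monoid.simps by blast
qed

lemma one_eq: "\<one>\<^bsub>M\<^esub> = \<pi> []"
  by (simp add: quotient_monoid_def proj_word_def)

lemma proj_word_closed: "w \<in> lists G \<Longrightarrow> \<pi> w \<in> carrier M"
  by (auto simp: quotient_monoid_def proj_word_def quotientI)

lemma carrierE:
  assumes "g \<in> carrier M"
  obtains w where "w \<in> lists G" "g = \<pi> w"
proof -
  have "g \<in> lists G // R"
    using assms by (simp add: quotient_monoid_def)
  then show thesis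
    by (rule quotientE) (use that in \<open>simp add: proj_word_def\<close>)
qed

lemma group_M: "group M"
proof (rule groupI)
  fix x y
  assume "x \<in> carrier M" "y \<in> carrier M"
  then show "x \<otimes>\<^bsub>M\<^esub> y \<in> carrier M"
    by (elim carrierE) (simp add: proj_word_mult proj_word_closed)
next
  show "\<one>\<^bsub>M\<^esub> \<in> carrier M"
    by (simp add: one_eq proj_word_closed)
next
  fix x y z
  assume "x \<in> carrier M" "y \<in> carrier M" "z \<in> carrier M"
  then show "x \<otimes>\<^bsub>M\<^esub> y \<otimes>\<^bsub>M\<^esub> z = x \<otimes>\<^bsub>M\<^esub> (y \<otimes>\<^bsub>M\<^esub> z)"
    by (elim carrierE) (simp add: proj_word_mult)
next
  fix x
  assume "x \<in> carrier M"
  then show "\<one>\<^bsub>M\<^esub> \<otimes>\<^bsub>M\<^esub> x = x"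
    unfolding one_eq by (elim carrierE) (simp add: proj_word_mult)
next
  fix x
  assume "x \<in> carrier M"
  then obtain w where "w \<in> lists G" "x = \<pi> w"
    by (rule carrierE)
  then show "\<exists>y\<in>carrier M. y \<otimes>\<^bsub>M\<^esub> x = \<one>\<^bsub>M\<^esub>"
    using inverse_word[of w] proj_word_mult[of "\<psi> w" w] proj_word_closed[of "\<psi> w"] by metis
qed

sublocale M: group M
  by (rule group_M)

lemma shift_apply: "j \<in> carrier M \<Longrightarrow> shift M i x j = x (i \<otimes>\<^bsub>M\<^esub> j)"
  by (simp add: shift_def)

text \<open>Because indices are multiplied from the left, shifts compose in reversed order, which
  matters for words of shifts below.\<close>

lemma shift_shift:
  assumes "g \<in> carrier M" "h \<in> carrier M"
  shows "shift M g (shift M h x) = shift M (h \<otimes>\<^bsub>M\<^esub> g) x"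
  using assms by (auto simp: shift_def M.m_assoc)

lemma X_subset: "X \<subseteq> carrier M \<rightarrow>\<^sub>E UNIV" and Y_subset: "Y \<subseteq> carrier M \<rightarrow>\<^sub>E UNIV"
  using subshift_X subshift_Y closedin_subset[of "config_topology M" X]
    closedin_subset[of "config_topology M" Y]
  by (simp_all add: subshift_def config_topology_def)

lemma shift_closed_X: "g \<in> carrier M \<Longrightarrow> x \<in> X \<Longrightarrow> shift M g x \<in> X"
  and shift_closed_Y: "g \<in> carrier M \<Longrightarrow> y \<in> Y \<Longrightarrow> shift M g y \<in> Y"
  using subshift_X subshift_Y by (auto simp: subshift_def)

lemma shift_one: "x \<in> X \<Longrightarrow> shift M \<one>\<^bsub>M\<^esub> x = x"
  using X_subset by (auto simp: shift_def fun_eq_iff PiE_def extensional_def)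

lemma shift_commute_generator:
  assumes "g \<in> G" "h \<in> carrier M" "x \<in> X"
  shows "shift M (\<pi> [g]) (shift M h x) = shift M h (shift M (\<pi> [g]) x)"
proof -
  obtain y where y: "y \<in> Y"
    using Y_nonempty by blast
  have "shift_fst M X Y (\<pi> [g]) (map_prod (shift M h) (shift M h) (x, y)) =
      map_prod (shift M h) (shift M h) (shift_fst M X Y (\<pi> [g]) (x, y))"
    using shifts_are_automorphisms[OF assms(1)] assms y
    unfolding automorphism_group_def Let_def by auto
  then show ?thesis
    using assms y shift_closed_X shift_closed_Y by (simp add: shift_fst_def)
qed

lemma shift_commute:
  assumes "w \<in> lists G" "h \<in> carrier M" "x \<in> X"
  shows "shift M (\<pi> w) (shift M h x) = shift M h (shift M (\<pi> w) x)"
  using assms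
proof (induction w arbitrary: x)
  case Nil
  then show ?case
    by (simp add: one_eq[symmetric] shift_one shift_closed_X)
next
  case (Cons g w)
  then have g: "g \<in> G" "w \<in> lists G" "\<pi> [g] \<in> carrier M" "\<pi> w \<in> carrier M"
    by (auto intro: proj_word_closed)
  have *: "shift M (\<pi> (g # w)) x = shift M (\<pi> w) (shift M (\<pi> [g]) x)" for x
    using g by (simp add: shift_shift proj_word_mult)
  show ?case
    using Cons g by (simp add: * shift_commute_generator shift_closed_X)
qed

text \<open>This is commutation of shifts evaluated at the identity. A shift by \<open>w\<close>
  brings the cell with \<open>\<pi> w\<close> on the left to position \<open>g\<close>, whereas a
  cylinder condition at \<open>g\<close> inspects the cell with \<open>\<pi> w\<close> on the
  right.\<close>

lemma commute_apply:
  assumes "w \<in> lists G" "g \<in> carrier M" "x \<in> X"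
  shows "x (\<pi> w \<otimes>\<^bsub>M\<^esub> g) = x (g \<otimes>\<^bsub>M\<^esub> \<pi> w)"
proof -
  have "shift M (\<pi> w) (shift M g x) \<one>\<^bsub>M\<^esub> = shift M g (shift M (\<pi> w) x) \<one>\<^bsub>M\<^esub>"
    using shift_commute[OF assms] by simp
  then show ?thesis
    using assms by (simp add: shift_shift shift_apply proj_word_closed)
qed

section \<open>Changing letters at a set of positions\<close>

definition modify :: "(nat list set \<Rightarrow> bool) \<Rightarrow> ('b \<Rightarrow> 'b) \<Rightarrow> (nat list set \<Rightarrow> 'b) \<Rightarrow> nat list set \<Rightarrow> 'b"
  where "modify P \<alpha> y = (\<lambda>g\<in>carrier M. if P g then \<alpha> (y g) else y g)"

text \<open>Shift \<open>g\<close> to the identity, apply permutability there, and shift back by the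
  inverse.\<close>

lemma permutable_modify_single:
  assumes \<alpha>: "permutable M \<alpha> Y" and y: "y \<in> Y" and g: "g \<in> carrier M"
  shows "y(g := \<alpha> (y g)) \<in> Y"
proof -
  define z where "z = shift M g y"
  have "shift M (inv\<^bsub>M\<^esub> g) (z(\<one>\<^bsub>M\<^esub> := \<alpha> (z \<one>\<^bsub>M\<^esub>))) \<in> Y"
    using \<alpha> y g shift_closed_Y by (auto simp: permutable_def z_def)
  moreover have "shift M (inv\<^bsub>M\<^esub> g) (z(\<one>\<^bsub>M\<^esub> := \<alpha> (z \<one>\<^bsub>M\<^esub>))) = y(g := \<alpha> (y g))"
  proof
    fix j
    show "shift M (inv\<^bsub>M\<^esub> g) (z(\<one>\<^bsub>M\<^esub> := \<alpha> (z \<one>\<^bsub>M\<^esub>))) j = (y(g := \<alpha> (y g))) j"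
    proof (cases "j \<in> carrier M")
      case True
      have "inv\<^bsub>M\<^esub> g \<otimes>\<^bsub>M\<^esub> j = \<one>\<^bsub>M\<^esub> \<longleftrightarrow> j = g"
        using True g by (metis M.inv_closed M.inv_inv M.inv_equality M.l_inv)
      then show ?thesis
        using True g by (simp add: z_def shift_apply M.m_assoc[symmetric])
    next
      case False
      then show ?thesis
        using g y Y_subset by (auto simp: shift_def PiE_def extensional_def)
    qed
  qed
  ultimately show ?thesis
    by simp
qed

lemma permutable_modify_finite:
  assumes \<alpha>: "permutable M \<alpha> Y" and y: "y \<in> Y" and F: "finite F" "F \<subseteq> carrier M"
  shows "(\<lambda>g. if g \<in> F then \<alpha> (y g) else y g) \<in> Y"
  using F
proof (induction F)
  case (insert f F)
  let ?z = "\<lambda>g. if g \<in> F then \<alpha> (y g) else y g"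
  have "?z(f := \<alpha> (?z f)) = (\<lambda>g. if g \<in> insert f F then \<alpha> (y g) else y g)"
    using insert.hyps by auto
  then show ?case
    using permutable_modify_single[OF \<alpha>, of ?z f] insert by auto
qed (use y in simp)

text \<open>\<open>Y\<close> is closed and a basic neighbourhood constrains only finitely many
  positions, so finite modifications approximate the full one.\<close>

lemma permutable_modify:
  assumes \<alpha>: "permutable M \<alpha> Y" and y: "y \<in> Y"
  shows "modify P \<alpha> y \<in> Y"
proof -
  let ?T = "config_topology M :: (nat list set \<Rightarrow> 'b) topology"
  have "modify P \<alpha> y \<in> ?T closure_of Y"
    unfolding in_closure_of
  proof (intro conjI allI impI)
    show "modify P \<alpha> y \<in> topspace ?T"
      by (simp add: config_topology_def modify_def)
    fix T
    assume "modify P \<alpha> y \<in> T \<and> openin ?T T"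
    then obtain U where U: "finite {i \<in> carrier M. U i \<noteq> UNIV}"
        "modify P \<alpha> y \<in> Pi\<^sub>E (carrier M) U" "Pi\<^sub>E (carrier M) U \<subseteq> T"
      unfolding config_topology_def openin_product_topology_alt by fastforce
    \<comment> \<open>This agrees with \<open>modify P \<alpha> y\<close> at the constrained
      positions and with \<open>y\<close> elsewhere.\<close>
    let ?z = "\<lambda>g. if g \<in> {i \<in> carrier M. U i \<noteq> UNIV \<and> P i} then \<alpha> (y g) else y g"
    have "?z \<in> Y"
      by (rule permutable_modify_finite[OF \<alpha> y]) (auto intro: finite_subset[OF _ U(1)])
    moreover have "?z \<in> Pi\<^sub>E (carrier M) U"
    proof (rule PiE_I)
      fix g
      assume "g \<in> carrier M"
      then show "?z g \<in> U g"
        using PiE_mem[OF U(2), of g] by (auto simp: modify_def split: if_splits)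
    next
      fix g
      assume "g \<notin> carrier M"
      then show "?z g = undefined"
        using y Y_subset by (auto simp: PiE_def extensional_def)
    qed
    ultimately show "\<exists>z. z \<in> Y \<and> z \<in> T"
      using U(3) by blast
  qed
  then show ?thesis
    using subshift_Y by (simp add: subshift_def closure_of_closedin)
qed

lemma modify_id: "y \<in> Y \<Longrightarrow> (\<And>g. g \<in> carrier M \<Longrightarrow> \<not> P g) \<Longrightarrow> modify P \<alpha> y = y"
  using Y_subset by (auto simp: modify_def fun_eq_iff PiE_def extensional_def)

section \<open>Words as maps and the word problem\<close>

definition run where "run = foldr (generator_map G R X Y)"

text \<open>The rightmost generator acts first, as in the product that defines
  \<open>word_problem\<close>.\<close>

lemma run_append: "run (u @ v) p = run u (run v p)"
  by (simp add: run_def)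

lemma run_Nil: "run [] p = p"
  and run_Cons: "run (s # w) p = generator_map G R X Y s (run w p)"
  by (simp_all add: run_def)

text \<open>The support of a one-letter pattern is the empty word, and \<open>shift M g x\<close>
  takes the value \<open>x g\<close> at the identity.\<close>

lemma generator_map_Control:
  assumes "x \<in> X" "y \<in> Y"
  shows "generator_map G R X Y (Control a b c d) (x, y) =
    (x, modify (\<lambda>g. x g = a) (three_cycle b c d) y)"
proof -
  have "shift M g x \<in> cylinder G R [[] \<mapsto> a] \<longleftrightarrow> x g = a" if "g \<in> carrier M" for g
    using shift_closed_X[OF that assms(1)] X_subset that
    by (auto simp: cylinder_def one_eq[symmetric] shift_apply)
  then show ?thesis
    using assms by (auto simp: controlled_def modify_def)
qed

lemma three_cycle_cubed:
  "distinct [a, b, c] \<Longrightarrow> three_cycle a b c (three_cycle a b c (three_cycle a b c x)) = x"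
  by (auto simp: three_cycle_def)

lemma generator_map_Bij:
  assumes "s \<in> generators G B'"
  shows "generator_map G R X Y s \<in> Bij (X \<times> Y)"
proof (cases s)
  case (Shift g)
  then show ?thesis
    using assms shifts_are_automorphisms[of g]
    by (auto simp: generators_def automorphism_group_def Let_def)
next
  case (Control a b c d)
  let ?f = "generator_map G R X Y s"
  have bcd: "b \<in> B'" "c \<in> B'" "d \<in> B'" "distinct [b, c, d]"
    using assms Control by (auto simp: generators_def)
  have f: "?f (x, y) = (x, modify (\<lambda>g. x g = a) (three_cycle b c d) y)"
    if "x \<in> X" "y \<in> Y" for x y
    using generator_map_Control that Control by simp
  have closed: "?f p \<in> X \<times> Y" if "p \<in> X \<times> Y" for p
    using that f permutable_modify[OF cycles_permute[OF bcd]] by (cases p) auto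
  have cubed: "?f (?f (?f p)) = p" if p: "p \<in> X \<times> Y" for p
  proof -
    obtain x y where xy: "p = (x, y)" "x \<in> X" "y \<in> Y"
      using p by auto
    have "modify P \<alpha> (modify P \<alpha> (modify P \<alpha> y)) = y" if "\<And>b. \<alpha> (\<alpha> (\<alpha> b)) = b" for P \<alpha>
      using that xy Y_subset by (auto simp: modify_def fun_eq_iff PiE_def extensional_def)
    with xy show ?thesis
      using permutable_modify[OF cycles_permute[OF bcd]] three_cycle_cubed[OF bcd(4)]
      by (simp add: f)
  qed
  \<comment> \<open>The cube of the control is the identity on \<open>X \<times> Y\<close>, so its
    square is a two-sided inverse.\<close>
  have "bij_betw ?f (X \<times> Y) (X \<times> Y)"
    by (rule bij_betw_byWitness[where f' = "\<lambda>p. ?f (?f p)"]) (use closed cubed in blast)+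
  moreover have "?f \<in> extensional (X \<times> Y)"
    by (simp add: Control controlled_def)
  ultimately show ?thesis
    by (simp add: Bij_def)
qed

lemma generated_group_one: "\<one>\<^bsub>generated_group G R X Y B'\<^esub> = restrict (\<lambda>p. p) (X \<times> Y)"
  by (simp add: generated_group_def automorphism_group_def Let_def BijGroup_def
      subgroup_generated_def)

text \<open>\<open>BijGroup\<close> defines its product by restriction to bijections, hence the
  premises; passing to a subgroup keeps product and unit.\<close>

lemma generated_group_mult:
  assumes "f \<in> Bij (X \<times> Y)" "h \<in> Bij (X \<times> Y)"
  shows "f \<otimes>\<^bsub>generated_group G R X Y B'\<^esub> h = compose (X \<times> Y) f h"
  using assms by (simp add: generated_group_def automorphism_group_def Let_def BijGroup_def
      subgroup_generated_def)

text \<open>Membership in \<open>Bij\<close> is carried through the induction because the product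
  with the next generator is composition only for bijections.\<close>

lemma foldr_mult_eq_run:
  assumes "w \<in> lists (generators G B')"
  shows "foldr (\<otimes>\<^bsub>generated_group G R X Y B'\<^esub>) (map (generator_map G R X Y) w)
      \<one>\<^bsub>generated_group G R X Y B'\<^esub> = restrict (run w) (X \<times> Y)
    \<and> restrict (run w) (X \<times> Y) \<in> Bij (X \<times> Y)"
  using assms
proof (induction w)
  case Nil
  have "restrict (run []) (X \<times> Y) = restrict (\<lambda>p. p) (X \<times> Y)"
    by (rule restrict_ext) (simp add: run_Nil)
  then show ?case
    using id_Bij[of "X \<times> Y"] by (simp only: generated_group_one list.map foldr.simps id_apply)
next
  case (Cons s w)
  let ?s = "generator_map G R X Y s" and ?w = "restrict (run w) (X \<times> Y)"
  have "s \<in> generators G B'" "w \<in> lists (generators G B')"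
    using Cons.hyps by simp_all
  then have s: "?s \<in> Bij (X \<times> Y)" and w: "?w \<in> Bij (X \<times> Y)"
    using Cons.IH generator_map_Bij by blast+
  have "compose (X \<times> Y) ?s ?w = restrict (run (s # w)) (X \<times> Y)"
    unfolding compose_def by (rule restrict_ext) (simp add: run_Cons)
  then show ?case
    using Cons.IH generated_group_mult[OF s w] compose_Bij[OF s w]
    by (simp only: list.map foldr.simps comp_apply)
qed

lemma mem_word_problem_iff:
  assumes "w \<in> lists (generators G B')"
  shows "w \<in> word_problem (generated_group G R X Y B') (generators G B') (generator_map G R X Y)
    \<longleftrightarrow> (\<forall>p\<in>X \<times> Y. run w p = p)"
proof -
  have "w \<in> word_problem (generated_group G R X Y B') (generators G B') (generator_map G R X Y)
    \<longleftrightarrow> restrict (run w) (X \<times> Y) = restrict (\<lambda>p. p) (X \<times> Y)"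
    unfolding word_problem_def
    using foldr_mult_eq_run[OF assms] generated_group_one assms by force
  also have "\<dots> \<longleftrightarrow> (\<forall>p\<in>X \<times> Y. run w p = p)"
  proof
    assume eq: "restrict (run w) (X \<times> Y) = restrict (\<lambda>p. p) (X \<times> Y)"
    show "\<forall>p\<in>X \<times> Y. run w p = p"
    proof
      fix p
      assume "p \<in> X \<times> Y"
      then show "run w p = p"
        using fun_cong[OF eq, of p] by (simp only: restrict_apply')
    qed
  qed (rule restrict_ext, blast)
  finally show ?thesis .
qed

lemma Shift_word_closed: "w \<in> lists G \<Longrightarrow> map Shift w \<in> lists (generators G B')"
  by (induction w) (auto simp: generators_def)

text \<open>The rightmost letter shifts first and composition reverses factors, so the letters of
  \<open>w\<close> would be multiplied in reverse; commutation of shifts on \<open>X\<close>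
  restores their order.\<close>

lemma run_Shift:
  assumes "w \<in> lists G" "x \<in> X" "y \<in> Y"
  shows "run (map Shift w) (x, y) = (shift M (\<pi> w) x, y)"
  using assms
proof (induction w)
  case Nil
  then show ?case
    by (simp add: run_Nil one_eq[symmetric] shift_one)
next
  case (Cons g w)
  then have g: "g \<in> G" "w \<in> lists G" "\<pi> [g] \<in> carrier M" "\<pi> w \<in> carrier M"
    by (auto intro: proj_word_closed)
  then have "shift M (\<pi> [g]) (shift M (\<pi> w) x) = shift M (\<pi> (g # w)) x"
    using Cons.prems shift_commute_generator[of g "\<pi> w" x] by (simp add: shift_shift proj_word_mult)
  then show ?case
    using Cons g by (simp add: run_Cons shift_fst_def shift_closed_X)
qed

end

section \<open>Words for controlled maps\<close>

definition append_codes :: "nat \<Rightarrow> nat \<Rightarrow> nat" where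
  "append_codes x y = list_encode (list_decode x @ list_decode y)"

text \<open>Doubling is \<open>sum_encode (Inl z)\<close>, the code of \<open>Shift z\<close>; the
  code of a word over \<open>G\<close> thus becomes that of a word of shifts.\<close>

definition shift_append :: "nat \<Rightarrow> nat \<Rightarrow> nat" where
  "shift_append x y = list_encode (map (\<lambda>z. z + z) (list_decode x) @ list_decode y)"

lemma total_recursive_append_codes:
  assumes "total_recursive n f" "total_recursive n g"
  shows "total_recursive n (\<lambda>xs. append_codes (f xs) (g xs))"
  unfolding append_codes_def by (rule total_recursive_append[OF assms])

lemma total_recursive_shift_append:
  assumes "total_recursive n f" "total_recursive n g"
  shows "total_recursive n (\<lambda>xs. shift_append (f xs) (g xs))"
  unfolding shift_append_def
  by (intro total_recursive_map_append total_recursive_add total_recursive_nth assms) simp_all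

lemma append_codes:
  "append_codes (generator_word_code u) (generator_word_code v) = generator_word_code (u @ v)"
  by (simp add: append_codes_def generator_word_code_def)

lemma shift_append:
  "shift_append (list_encode w) (generator_word_code v) = generator_word_code (map Shift w @ v)"
  by (simp add: shift_append_def generator_word_code_def comp_def sum_encode_def mult_2)

section \<open>Decoding patterns\<close>

lemma set_decode_less: "k \<in> set_decode n \<Longrightarrow> k < n"
  by (rule ccontr) (use less_exp[of k] in \<open>auto simp: set_decode_def not_less
    dest!: order.strict_trans1\<close>)

text \<open>\<open>set_decode\<close> inverts \<open>set_encode\<close> on finite sets, and the
  graph of a pattern is finite because its support is.\<close>

lemma pattern_code_decode:
  assumes "u \<in> patterns G"
  shows "set_decode (pattern_code u) =
    (\<lambda>(w, a). prod_encode (list_encode w, to_nat a)) ` Map.graph u"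
proof -
  have "Map.graph u = (\<lambda>w. (w, the (u w))) ` dom u"
    by (auto simp: Map.graph_def image_iff domI)
  then have "finite (Map.graph u)"
    using assms by (simp add: patterns_def)
  then show ?thesis
    by (simp add: pattern_code_def)
qed

lemma inj_on_pattern_code: "inj_on pattern_code (patterns G)"
proof (rule inj_onI)
  fix u v :: "'a pattern"
  assume uv: "u \<in> patterns G" "v \<in> patterns G" "pattern_code u = pattern_code v"
  have "inj (\<lambda>(w, a :: 'a). prod_encode (list_encode w, to_nat a))"
    by (auto intro!: injI simp: list_encode_eq)
  moreover have "(\<lambda>(w, a). prod_encode (list_encode w, to_nat a)) ` Map.graph u =
      (\<lambda>(w, a). prod_encode (list_encode w, to_nat a)) ` Map.graph v"
    using uv by (metis pattern_code_decode)
  ultimately have "Map.graph u = Map.graph v"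
    by (simp add: inj_image_eq_iff)
  then have "u w = Some a \<longleftrightarrow> v w = Some a" for w a
    by (auto simp: Map.graph_def set_eq_iff)
  then show "u = v"
    by (metis option.exhaust ext)
qed

lemma cell_of_pattern:
  fixes u :: "'a::finite pattern"
  assumes "u \<in> patterns G" "k \<in> set_decode (pattern_code u)"
  shows "list_decode (fst (prod_decode k)) \<in> lists G"
    "to_nat (from_nat (snd (prod_decode k)) :: 'a) = snd (prod_decode k)"
  using assms(2) assms(1) unfolding pattern_code_decode[OF assms(1)]
  by (auto simp: Map.graph_def patterns_def)

section \<open>The words of the reduction\<close>

locale reduction = controlled_product G R X Y B' \<psi>
  for G R and X :: "(nat list set \<Rightarrow> 'a::finite) set" and Y :: "(nat list set \<Rightarrow> 'b::finite) set"
    and B' \<psi> +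
  fixes p q r s t :: 'b
  assumes letters_distinct: "distinct [p, q, r, s, t]"
    and letters_in: "{p, q, r, s, t} \<subseteq> B'"
begin

text \<open>Read from the right: shift by \<open>w\<close>, apply (p q s)(q s t) = (p q)(s t) where
  the letter \<open>a\<close> is seen, and shift back by the inverse of \<open>w\<close>.\<close>

definition cell_word :: "nat list \<Rightarrow> 'a \<Rightarrow> ('a, 'b) generator list" where
  "cell_word w a = map Shift (\<psi> w) @ [Control a p q s, Control a q s t] @ map Shift w"

text \<open>Controlling by every letter in turn amounts to no control, so this list provides the
  unconditional 3-cycle.\<close>

definition letter_list :: "'a list" where
  "letter_list = (SOME l. distinct l \<and> set l = UNIV)"

text \<open>A set bit \<open>k\<close> adds its cell to the control by the commutator word
  \<open>e v e v v\<close>. The recursion follows the bits of the code \<open>n\<close> rather than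
  the pattern, so that it has the shape of a primitive recursion.\<close>

primrec pattern_word :: "nat \<Rightarrow> nat \<Rightarrow> ('a, 'b) generator list" where
  "pattern_word n 0 = map (\<lambda>a. Control a p q r) letter_list"
| "pattern_word n (Suc k) =
     (if k \<in> set_decode n
      then let e = cell_word (list_decode (fst (prod_decode k))) (from_nat (snd (prod_decode k)));
               v = pattern_word n k
           in e @ v @ e @ v @ v
      else pattern_word n k)"

text \<open>The prefix acts trivially; it serves to make the map injective.\<close>

definition reduction_word :: "nat \<Rightarrow> ('a, 'b) generator list" where
  "reduction_word n = ((\<lambda>w. replicate 3 (Control undefined p q r) @ w) ^^ n)
     (replicate 3 (Control undefined q r p) @ pattern_word n n)"

text \<open>Codes of patterns have this property, which also allows several bits with the same word.
  The equation for \<open>to_nat\<close> makes the stored number the code of an actual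
  letter.\<close>

definition valid_code :: "nat \<Rightarrow> bool" where
  "valid_code n \<longleftrightarrow> (\<forall>k\<in>set_decode n. list_decode (fst (prod_decode k)) \<in> lists G \<and>
     to_nat (from_nat (snd (prod_decode k)) :: 'a) = snd (prod_decode k))"

lemma Control_closed:
  "distinct [b, c, d] \<Longrightarrow> b \<in> B' \<Longrightarrow> c \<in> B' \<Longrightarrow> d \<in> B' \<Longrightarrow> Control a b c d \<in> generators G B'"
  by (simp add: generators_def)

lemma cell_word_closed: "w \<in> lists G \<Longrightarrow> cell_word w a \<in> lists (generators G B')"
  using inverse_word[of w] Shift_word_closed[of w] Shift_word_closed[of "\<psi> w"]
    letters_distinct letters_in
  by (simp add: cell_word_def Control_closed)

lemma pattern_word_closed: "valid_code n \<Longrightarrow> pattern_word n k \<in> lists (generators G B')"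
proof (induction k)
  case 0
  then show ?case
    using letters_distinct letters_in by (auto intro!: Control_closed)
next
  case (Suc k)
  then show ?case
    using cell_word_closed by (simp add: Let_def valid_code_def)
qed

lemma reduction_word_eq:
  "reduction_word n = replicate (3 * n) (Control undefined p q r) @
     replicate 3 (Control undefined q r p) @ pattern_word n n"
proof -
  have "((\<lambda>w. replicate 3 a @ w) ^^ m) v = replicate (3 * m) a @ v" for a m and v :: "'c list"
    by (induction m) (simp_all add: replicate_add)
  then show ?thesis
    by (simp add: reduction_word_def)
qed

lemma reduction_word_closed: "valid_code n \<Longrightarrow> reduction_word n \<in> lists (generators G B')"
  using pattern_word_closed[of n n] letters_distinct letters_in
    Control_closed[of p q r undefined] Control_closed[of q r p undefined]
  by (auto simp: reduction_word_eq)

text \<open>The initial run of \<open>Control undefined p q r\<close> has length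
  \<open>3 * n\<close>, being cut off by the block of the different generator
  \<open>Control undefined q r p\<close>, so \<open>n\<close> can be read off.\<close>

lemma inj_reduction_word: "inj reduction_word"
proof (rule injI)
  have neq: "Control undefined p q r \<noteq> (Control undefined q r p :: ('a, 'b) generator)"
    using letters_distinct by auto
  have "length (takeWhile (\<lambda>c. c = a) (replicate m a @ replicate 3 b @ v)) = m"
    if "a \<noteq> b" for a b m and v :: "'c list"
    using that by (induction m) (simp_all add: numeral_3_eq_3)
  from this[OF neq] have "length (takeWhile (\<lambda>c. c = Control undefined p q r) (reduction_word n)) = 3 * n"
    for n
    unfolding reduction_word_eq .
  then show "m = n" if "reduction_word m = reduction_word n" for m n
    using that by (metis mult_cancel1 zero_neq_numeral)
qed

section \<open>The action of the words\<close>

definition \<gamma> where "\<gamma> = three_cycle p q r"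
definition \<beta> where "\<beta> = three_cycle p q s \<circ> three_cycle q s t"

text \<open>\<beta> exchanges \<open>p\<close> and \<open>q\<close> and fixes \<open>r\<close>, so
  it conjugates \<gamma> to its inverse, whence the last identity. The three identities settle the
  positions where only the condition on \<gamma>, only the one on \<beta>, or both hold.\<close>

lemma \<gamma>_cubed: "\<gamma> (\<gamma> (\<gamma> b)) = b"
  and \<beta>_squared: "\<beta> (\<beta> b) = b"
  and \<beta>_conj_\<gamma>: "\<beta> (\<gamma> (\<beta> (\<gamma> (\<gamma> b)))) = \<gamma> b"
  using letters_distinct by (auto simp: \<gamma>_def \<beta>_def three_cycle_def)

lemma modify_cycle_closed:
  "a \<in> B' \<Longrightarrow> b \<in> B' \<Longrightarrow> c \<in> B' \<Longrightarrow> distinct [a, b, c] \<Longrightarrow> y \<in> Y \<Longrightarrow>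
   modify P (three_cycle a b c) y \<in> Y"
  by (rule permutable_modify[OF cycles_permute])

lemma modify_\<gamma>_closed: "y \<in> Y \<Longrightarrow> modify P \<gamma> y \<in> Y"
  using modify_cycle_closed letters_distinct letters_in by (simp add: \<gamma>_def)

lemma modify_modify: "modify P \<alpha> (modify P \<alpha>' y) = modify P (\<alpha> \<circ> \<alpha>') y"
  by (auto simp: modify_def)

lemma modify_\<beta>_closed: "y \<in> Y \<Longrightarrow> modify P \<beta> y \<in> Y"
  using modify_cycle_closed letters_distinct letters_in
  by (simp add: \<beta>_def modify_modify[symmetric])

lemma run_cell_word:
  assumes w: "w \<in> lists G" and x: "x \<in> X" and y: "y \<in> Y"
  shows "run (cell_word w a) (x, y) = (x, modify (\<lambda>g. x (g \<otimes>\<^bsub>M\<^esub> \<pi> w) = a) \<beta> y)"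
proof -
  define x' where "x' = shift M (\<pi> w) x"
  have \<psi>w: "\<psi> w \<in> lists G"
    using inverse_word w by blast
  have x': "x' \<in> X"
    using w x by (simp add: x'_def shift_closed_X proj_word_closed)
  \<comment> \<open>Shifting by \<open>w\<close> and then by \<open>\<psi> w\<close> is shifting by
    the class of \<open>w @ \<psi> w\<close>, which is the identity.\<close>
  have "shift M (\<pi> (\<psi> w)) x' = x"
    using w x \<psi>w inverse_word[OF w]
    by (simp add: x'_def shift_shift proj_word_closed proj_word_mult shift_one)
  moreover have "modify P (three_cycle p q s) (modify P (three_cycle q s t) y) = modify P \<beta> y"
    "modify P (three_cycle q s t) y \<in> Y" for P
    using y modify_cycle_closed letters_distinct letters_in
    by (simp_all add: \<beta>_def modify_modify)
  moreover have "modify (\<lambda>g. x' g = a) \<beta> y = modify (\<lambda>g. x (g \<otimes>\<^bsub>M\<^esub> \<pi> w) = a) \<beta> y"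
    unfolding modify_def
    by (rule restrict_ext) (simp add: x'_def shift_apply commute_apply[OF w _ x])
  ultimately show ?thesis
    using w x y \<psi>w x' modify_\<beta>_closed[OF y] x'_def[symmetric]
    by (simp add: cell_word_def run_append run_Cons run_Nil run_Shift generator_map_Control
        del: generator_map.simps)
qed

text \<open>Each position carries exactly one letter and the letters of \<open>l\<close> are
  distinct, so \<gamma> is applied there at most once.\<close>

lemma run_letters:
  assumes "distinct l" "x \<in> X" "y \<in> Y"
  shows "run (map (\<lambda>a. Control a p q r) l) (x, y) = (x, modify (\<lambda>g. x g \<in> set l) \<gamma> y)"
  using assms
proof (induction l)
  case Nil
  then show ?case
    by (simp add: run_Nil modify_id)
next
  case (Cons a l)
  have "modify (\<lambda>g. x g = a) \<gamma> (modify (\<lambda>g. x g \<in> set l) \<gamma> y) = modify (\<lambda>g. x g \<in> set (a # l)) \<gamma> y"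
    using Cons.prems by (auto simp: modify_def)
  then show ?case
    using Cons modify_\<gamma>_closed
    by (simp add: run_Cons generator_map_Control \<gamma>_def del: generator_map.simps)
qed

text \<open>
  The word \<open>\<beta> \<gamma> \<beta> \<gamma> \<gamma>\<close> is the commutator of \<open>\<beta> = \<beta>\<^sup>-\<^sup>1\<close> and \<open>\<gamma>\<close>, because \<open>\<gamma>\<^sup>3 = 1\<close>.
\<close>

lemma modify_commutator:
  "modify P \<beta> (modify Q \<gamma> (modify P \<beta> (modify Q \<gamma> (modify Q \<gamma> y)))) =
   modify (\<lambda>g. P g \<and> Q g) \<gamma> y"
  unfolding modify_def by (rule restrict_ext) (simp add: \<gamma>_cubed \<beta>_squared \<beta>_conj_\<gamma>)

lemma run_pattern_word:
  assumes n: "valid_code n" and x: "x \<in> X" and y: "y \<in> Y"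
  shows "run (pattern_word n k) (x, y) =
    (x, modify (\<lambda>g. \<forall>j\<in>set_decode n. j < k \<longrightarrow>
      x (g \<otimes>\<^bsub>M\<^esub> \<pi> (list_decode (fst (prod_decode j)))) = from_nat (snd (prod_decode j))) \<gamma> y)"
proof -
  define P where "P k g \<longleftrightarrow>
    x (g \<otimes>\<^bsub>M\<^esub> \<pi> (list_decode (fst (prod_decode k)))) = from_nat (snd (prod_decode k))" for k g
  have "run (pattern_word n k) (x, y) =
      (x, modify (\<lambda>g. \<forall>j\<in>set_decode n. j < k \<longrightarrow> P j g) \<gamma> y)"
    using y
  \<comment> \<open>\<open>y\<close> varies because the hypothesis is applied to configurations that
    are already modified.\<close>
  proof (induction k arbitrary: y)
    case 0
    \<comment> \<open>Every position carries a letter of the full list, so \<gamma> acts everywhere,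
      as an empty set of conditions demands.\<close>
    have "distinct letter_list \<and> set letter_list = UNIV"
      unfolding letter_list_def by (rule someI_ex) (metis finite_distinct_list finite)
    then show ?case
      using run_letters[of letter_list x y] x 0 by simp
  next
    case (Suc k)
    define Q where "Q g \<longleftrightarrow> (\<forall>j\<in>set_decode n. j < k \<longrightarrow> P j g)" for g
    note IH = Suc.IH[folded Q_def]
    show ?case
    proof (cases "k \<in> set_decode n")
      case True
      define w where "w = list_decode (fst (prod_decode k))"
      define a :: 'a where "a = from_nat (snd (prod_decode k))"
      have "w \<in> lists G"
        using n True by (simp add: valid_code_def w_def)
      then have cell: "run (cell_word w a) (x, y) = (x, modify (P k) \<beta> y)" if "y \<in> Y" for y
        using run_cell_word[OF _ x that] by (simp add: P_def[abs_def] w_def a_def)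
      have "run (pattern_word n (Suc k)) (x, y) = (x, modify (\<lambda>g. P k g \<and> Q g) \<gamma> y)"
        using True Suc.prems
        by (simp add: Let_def run_append w_def[symmetric] a_def[symmetric] IH cell
            modify_\<gamma>_closed modify_\<beta>_closed modify_commutator)
      moreover have "(\<lambda>g. P k g \<and> Q g) = (\<lambda>g. \<forall>j\<in>set_decode n. j < Suc k \<longrightarrow> P j g)"
        using True by (auto simp: Q_def less_Suc_eq)
      ultimately show ?thesis
        by simp
    next
      case False
      then have "Q = (\<lambda>g. \<forall>j\<in>set_decode n. j < Suc k \<longrightarrow> P j g)"
        by (auto simp: Q_def less_Suc_eq)
      then show ?thesis
        using False IH[OF Suc.prems] by simp
    qed
  qed
  then show ?thesis
    unfolding P_def .
qed

lemma run_replicate_3: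
  assumes "b \<in> B'" "c \<in> B'" "d \<in> B'" "distinct [b, c, d]" "x \<in> X" "y \<in> Y"
  shows "run (replicate 3 (Control a b c d)) (x, y) = (x, y)"
proof -
  have "modify P (three_cycle b c d) (modify P (three_cycle b c d) (modify P (three_cycle b c d) y)) = y"
    for P
    using assms Y_subset three_cycle_cubed[of b c d]
    by (auto simp: modify_def fun_eq_iff PiE_def extensional_def)
  then show ?thesis
    using assms modify_cycle_closed
    by (simp add: numeral_3_eq_3 run_Cons run_Nil generator_map_Control del: generator_map.simps)
qed

lemma run_reduction_word:
  assumes "valid_code n" and "x \<in> X" "y \<in> Y"
  shows "run (reduction_word n) (x, y) =
    (x, modify (\<lambda>g. \<forall>j\<in>set_decode n.
      x (g \<otimes>\<^bsub>M\<^esub> \<pi> (list_decode (fst (prod_decode j)))) = from_nat (snd (prod_decode j))) \<gamma> y)"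
proof -
  \<comment> \<open>The blocks of three act trivially on pairs from \<open>X \<times> Y\<close>, so
    \<open>v\<close> is assumed to lead to such a pair.\<close>
  have "run (((\<lambda>w. replicate 3 (Control undefined p q r) @ w) ^^ m) v) (x, y) = run v (x, y)"
    if "\<exists>y'\<in>Y. run v (x, y) = (x, y')" for m v
    using that letters_distinct letters_in assms
    by (induction m) (auto simp: run_append run_replicate_3)
  \<comment> \<open>A set bit \<open>j\<close> gives \<open>2 ^ j \<le> n\<close> and hence
    \<open>j < n\<close>, so the scan of the bits below \<open>n\<close> misses none.\<close>
  then show ?thesis
    using run_pattern_word[OF assms, of n] modify_\<gamma>_closed letters_distinct letters_in assms
      set_decode_less[of _ n]
    unfolding reduction_word_def by (auto simp: run_append run_replicate_3)
qed

section \<open>Computability of the reduction\<close>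

lemma computable_reduction_word:
  assumes "computable_on list_encode list_encode (lists G) \<psi>"
  shows "\<exists>F. partial_recursive 1 F \<and>
    (\<forall>n. valid_code n \<longrightarrow> F [n] = Some (generator_word_code (reduction_word n)))"
proof -
  obtain \<Psi> where \<Psi>: "partial_recursive 1 \<Psi>"
      "\<And>w. w \<in> lists G \<Longrightarrow> \<Psi> [list_encode w] = Some (list_encode (\<psi> w))"
    using assms by (auto simp: computable_on_def)
  \<comment> \<open>\<open>pattern_word n 0\<close> is the same for all \<open>n\<close>, so its
    code is a constant.\<close>
  define c0 :: nat where "c0 = generator_word_code (pattern_word 0 0)"
  \<comment> \<open>The algorithm for \<open>\<psi>\<close> may diverge outside \<open>lists G\<close>, so it is run on the code \<open>0\<close> of the
    empty word when bit \<open>k\<close> of \<open>n\<close> is not set.\<close>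
  define arg :: "nat list \<Rightarrow> nat" where
    "arg ys = (if ys ! 0 \<in> set_decode (ys ! 2) then fst (prod_decode (ys ! 0)) else 0)" for ys
  \<comment> \<open>These are the two controls of \<open>cell_word\<close>:
    \<open>Suc (2 * z)\<close> is \<open>sum_encode (Inr z)\<close>, and \<open>d\<close> is the
    code of the letter.\<close>
  define ctrl :: "nat \<Rightarrow> nat" where
    "ctrl d = list_encode [Suc (2 * list_encode [d, to_nat p, to_nat q, to_nat s]),
       Suc (2 * list_encode [d, to_nat q, to_nat s, to_nat t])]" for d
  define cell :: "nat \<Rightarrow> nat \<Rightarrow> nat" where
    "cell c k = shift_append c (append_codes (ctrl (snd (prod_decode k)))
       (shift_append (fst (prod_decode k)) 0))" for c k
  \<comment> \<open>The arguments are the code of \<open>\<psi> w\<close>, the index of the bit, the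
    code of the word so far, and \<open>n\<close>.\<close>
  define step :: "nat list \<Rightarrow> nat" where
    "step zs = (if zs ! 1 \<in> set_decode (zs ! 3)
      then append_codes (cell (zs ! 0) (zs ! 1)) (append_codes (zs ! 2)
        (append_codes (cell (zs ! 0) (zs ! 1)) (append_codes (zs ! 2) (zs ! 2))))
      else zs ! 2)" for zs
  define final :: "nat list \<Rightarrow> nat" where
    "final xs = ((\<lambda>w. append_codes (generator_word_code
        (replicate 3 (Control undefined p q r) :: ('a, 'b) generator list)) w) ^^ (xs ! 1))
      (append_codes (generator_word_code
        (replicate 3 (Control undefined q r p) :: ('a, 'b) generator list)) (xs ! 0))" for xs
  have "total_recursive 1 (\<lambda>xs. c0)"
    by (rule total_recursive_const)
  then obtain Base where Base: "partial_recursive 1 Base" "\<And>n. Base [n] = Some c0"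
    unfolding total_recursive_def by (metis length_Cons list.size(3) One_nat_def)
  have "total_recursive 3 arg"
    unfolding arg_def
    by (intro total_recursive_if_set_decode total_recursive_prod_decode total_recursive_const
        total_recursive_nth) simp_all
  then obtain Arg where Arg: "partial_recursive 3 Arg"
      "\<And>k v n. Arg [k, v, n] = Some (arg [k, v, n])"
    unfolding total_recursive_def by (auto simp: numeral_3_eq_3)
  have "total_recursive 4 step"
    unfolding step_def cell_def ctrl_def list_encode.simps mult_2
    by (intro total_recursive_if_set_decode total_recursive_append_codes
        total_recursive_shift_append total_recursive_Suc total_recursive_add
        total_recursive_prod_encode total_recursive_prod_decode total_recursive_const
        total_recursive_nth) simp_all
  then obtain Step where Step: "partial_recursive 4 Step"
      "\<And>c k v n. Step [c, k, v, n] = Some (step [c, k, v, n])"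
    unfolding total_recursive_def by (auto simp: numeral_eq_Suc)
  have "total_recursive 2 final"
    unfolding final_def
    by (intro total_recursive_funpow total_recursive_append_codes total_recursive_const
        total_recursive_nth) simp_all
  then obtain Final where Final: "partial_recursive 2 Final"
      "\<And>v n. Final [v, n] = Some (final [v, n])"
    unfolding total_recursive_def by (auto simp: numeral_2_eq_2)
  have proj: "i < m \<Longrightarrow> partial_recursive m (\<lambda>xs. Some (xs ! i))" for i m
    by (rule partial_recursive.proj)
  \<comment> \<open>\<open>\<Psi>\<close> may diverge, so from here on partial functions are
    composed: \<open>Query\<close> calls \<open>\<Psi>\<close>, \<open>Body\<close> treats one bit,
    and \<open>Loop\<close> iterates over the bits.\<close>
  define Query where "Query = (\<lambda>ys. Option.bind (those (map (\<lambda>g. g ys) [Arg])) \<Psi>)"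
  define Body where "Body = (\<lambda>ys. Option.bind (those (map (\<lambda>g. g ys)
      [Query, \<lambda>ys. Some (ys ! 0), \<lambda>ys. Some (ys ! 1), \<lambda>ys. Some (ys ! 2)])) Step)"
  define Loop where "Loop = (\<lambda>xs. rec_nat (Base (tl xs))
      (\<lambda>k r. Option.bind r (\<lambda>v. Body (k # v # tl xs))) (hd xs))"
  \<comment> \<open>\<open>n\<close> serves both as the number of rounds and as the parameter that
    holds the bits.\<close>
  define Run where "Run = (\<lambda>xs. Option.bind (those (map (\<lambda>g. g xs)
      [\<lambda>xs. Some (xs ! 0), \<lambda>xs. Some (xs ! 0)])) Loop)"
  define F where "F = (\<lambda>xs. Option.bind (those (map (\<lambda>g. g xs) [Run, \<lambda>xs. Some (xs ! 0)])) Final)"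
  have "partial_recursive 3 Query"
    unfolding Query_def by (rule partial_recursive.comp) (use Arg \<Psi> in auto)
  then have "partial_recursive 3 Body"
    unfolding Body_def by (intro partial_recursive.comp) (use Step proj in \<open>auto simp: numeral_eq_Suc\<close>)
  then have "partial_recursive 2 Loop"
    unfolding Loop_def
    using partial_recursive.prim_rec[of 1 Base Body] Base by (simp add: numeral_eq_Suc)
  then have "partial_recursive 1 Run"
    unfolding Run_def by (intro partial_recursive.comp) (use proj in \<open>auto simp: numeral_2_eq_2\<close>)
  then have "partial_recursive 1 F"
    unfolding F_def
    by (intro partial_recursive.comp) (use Final proj in \<open>auto simp: numeral_2_eq_2\<close>)
  moreover have "F [n] = Some (generator_word_code (reduction_word n))" if n: "valid_code n" for n
  proof -
    have "Loop [k, n] = Some (generator_word_code (pattern_word n k))" for k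
    proof (induction k)
      case 0
      then show ?case
        by (simp add: Loop_def Base c0_def)
    next
      case (Suc k)
      let ?v = "generator_word_code (pattern_word n k)"
      let ?w = "if k \<in> set_decode n then list_decode (fst (prod_decode k)) else []"
      have "?w \<in> lists G"
        using n by (simp add: valid_code_def)
      then have "Query [k, ?v, n] = Some (list_encode (\<psi> ?w))"
        using \<Psi>(2)[of ?w]
        by (cases "k \<in> set_decode n") (simp_all add: Query_def Arg arg_def)
      then have "Body [k, ?v, n] = Some (step [list_encode (\<psi> ?w), k, ?v, n])"
        by (simp add: Body_def Step numeral_2_eq_2)
      also have "step [list_encode (\<psi> ?w), k, ?v, n] = generator_word_code (pattern_word n (Suc k))"
      proof (cases "k \<in> set_decode n")
        case True
        \<comment> \<open>By \<open>valid_code\<close>, the number stored in the bit is the code of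
          the letter it decodes to, as \<open>ctrl\<close> presumes.\<close>
        let ?a = "from_nat (snd (prod_decode k)) :: 'a"
        have "ctrl (snd (prod_decode k)) =
            generator_word_code [Control ?a p q s, Control ?a q s t]"
          using n True by (simp add: ctrl_def generator_word_code_def valid_code_def sum_encode_def)
        moreover have "shift_append (fst (prod_decode k)) 0 =
            generator_word_code (map Shift ?w :: ('a, 'b) generator list)"
          using True shift_append[of ?w "[] :: ('a, 'b) generator list"]
          by (simp add: generator_word_code_def)
        ultimately have "cell (list_encode (\<psi> ?w)) k = generator_word_code (cell_word ?w ?a)"
          by (simp only: cell_def append_codes shift_append cell_word_def)
        then show ?thesis
          using True by (simp add: step_def append_codes Let_def numeral_2_eq_2 numeral_3_eq_3)
      next
        case False
        then show ?thesis
          by (simp add: step_def numeral_2_eq_2 numeral_3_eq_3)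
      qed
      finally show ?case
        using Suc by (simp add: Loop_def)
    qed
    then have "F [n] = Some (final [generator_word_code (pattern_word n n), n])"
      by (simp add: F_def Run_def Final)
    also have "final [generator_word_code (pattern_word n n), n] =
        generator_word_code (reduction_word n)"
    proof -
      have "((\<lambda>w. append_codes (generator_word_code l) w) ^^ m) (generator_word_code v) =
          generator_word_code (((\<lambda>w. l @ w) ^^ m) v)" for l v :: "('a, 'b) generator list" and m
        by (induction m) (simp_all add: append_codes)
      then show ?thesis
        by (simp add: final_def append_codes reduction_word_def)
    qed
    finally show ?thesis .
  qed
  ultimately show ?thesis
    by blast
qed

section \<open>Correctness of the reduction\<close>

lemma reduction_word_mem_word_problem:
  assumes u: "u \<in> patterns G" and letter: "\<exists>y\<in>Y. y \<one>\<^bsub>M\<^esub> \<in> B'"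
  shows "u \<in> colanguage G R X \<longleftrightarrow> reduction_word (pattern_code u) \<in>
    word_problem (generated_group G R X Y B') (generators G B') (generator_map G R X Y)"
proof -
  let ?n = "pattern_code u"
  let ?w = "\<lambda>j. list_decode (fst (prod_decode j))"
  have n: "valid_code ?n"
    using cell_of_pattern[OF u] by (simp add: valid_code_def)
  \<comment> \<open>The set bits are the cells of \<open>u\<close>, so the control collected at
    \<open>g\<close> is membership of the shifted configuration in the cylinder.\<close>
  have match: "(\<forall>j\<in>set_decode ?n. x (g \<otimes>\<^bsub>M\<^esub> \<pi> (?w j)) = from_nat (snd (prod_decode j))) \<longleftrightarrow>
      shift M g x \<in> cylinder G R u" if "g \<in> carrier M" for g x
  proof -
    have closed: "\<pi> w \<in> carrier M" if "u w = Some a" for w a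
      using u that by (intro proj_word_closed) (auto simp: patterns_def)
    have "shift M g x \<in> cylinder G R u \<longleftrightarrow> (\<forall>w\<in>dom u. shift M g x (\<pi> w) = the (u w))"
      by (simp add: cylinder_def shift_def)
    also have "\<dots> \<longleftrightarrow> (\<forall>w a. u w = Some a \<longrightarrow> shift M g x (\<pi> w) = a)"
      by (metis domD domI option.sel)
    also have "\<dots> \<longleftrightarrow> (\<forall>w a. u w = Some a \<longrightarrow> x (g \<otimes>\<^bsub>M\<^esub> \<pi> w) = a)"
      using closed by (metis shift_apply)
    also have "\<dots> \<longleftrightarrow>
        (\<forall>j\<in>set_decode ?n. x (g \<otimes>\<^bsub>M\<^esub> \<pi> (?w j)) = from_nat (snd (prod_decode j)))"
      by (auto simp: pattern_code_decode[OF u] Map.graph_def)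
    finally show ?thesis
      by blast
  qed
  have run: "run (reduction_word ?n) (x, y) =
      (x, modify (\<lambda>g. shift M g x \<in> cylinder G R u) \<gamma> y)" if "x \<in> X" "y \<in> Y" for x y
    unfolding run_reduction_word[OF n that] using match by (auto simp: modify_def)
  have "(\<forall>p\<in>X \<times> Y. run (reduction_word ?n) p = p) \<longleftrightarrow> cylinder G R u \<inter> X = {}"
  proof
    assume "cylinder G R u \<inter> X = {}"
    then show "\<forall>p\<in>X \<times> Y. run (reduction_word ?n) p = p"
      using shift_closed_X by (auto simp: run intro!: modify_id)
  next
    assume id: "\<forall>p\<in>X \<times> Y. run (reduction_word ?n) p = p"
    show "cylinder G R u \<inter> X = {}"
    proof (rule ccontr)
      assume "cylinder G R u \<inter> X \<noteq> {}"
      then obtain x where x: "x \<in> X" "x \<in> cylinder G R u"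
        by blast
      obtain y0 where y0: "y0 \<in> Y" "y0 \<one>\<^bsub>M\<^esub> \<in> B'"
        using letter by blast
      obtain y where y: "y \<in> Y" "y \<one>\<^bsub>M\<^esub> = p"
      proof (cases "y0 \<one>\<^bsub>M\<^esub> = p")
        case False
        \<comment> \<open>A third letter completes a 3-cycle that sends the letter of
          \<open>y0\<close> at the identity to \<open>p\<close>.\<close>
        obtain d where d: "d \<in> B'" "d \<noteq> p" "d \<noteq> y0 \<one>\<^bsub>M\<^esub>"
          using letters_distinct letters_in by (cases "y0 \<one>\<^bsub>M\<^esub> = q") auto
        let ?y = "modify (\<lambda>_. True) (three_cycle (y0 \<one>\<^bsub>M\<^esub>) p d) y0"
        have "?y \<in> Y"
          using modify_cycle_closed[of "y0 \<one>\<^bsub>M\<^esub>" p d] d False y0 letters_in by auto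
        moreover have "?y \<one>\<^bsub>M\<^esub> = p"
          using d False by (simp add: modify_def three_cycle_def)
        ultimately show ?thesis
          using that by blast
      qed (use y0 that in blast)
      \<comment> \<open>At the identity the shift is trivial, so the control holds there and
        \<gamma> sends \<open>p\<close> to \<open>q\<close>.\<close>
      have "modify (\<lambda>g. shift M g x \<in> cylinder G R u) \<gamma> y \<one>\<^bsub>M\<^esub> = q"
        using x y letters_distinct by (simp add: modify_def shift_one \<gamma>_def three_cycle_def)
      moreover have "modify (\<lambda>g. shift M g x \<in> cylinder G R u) \<gamma> y = y"
        using id x y run[of x y] by auto
      ultimately show False
        using y letters_distinct by simp
    qed
  qed
  then show ?thesis
    using u by (auto simp: mem_word_problem_iff[OF reduction_word_closed[OF n]] colanguage_def
        language_def)
qed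

end

text \<open>If no configuration of \<open>Y\<close> had a letter of \<open>B'\<close> at the
  identity, shift invariance would make every control the identity map; \<open>letter_occurs\<close>
  rules this out. \<open>shifts_are_automorphisms\<close> places the shifts of the first component
  in the ambient group, so that \<open>subgroup_generated\<close> keeps them as generators.\<close>

theorem theorem3:
  fixes G :: "nat set" and R :: "nat list rel"
    and X :: "(nat list set \<Rightarrow> 'a::finite) set"
    and Y :: "(nat list set \<Rightarrow> 'b::finite) set"
    and B' :: "'b set"
  assumes "monoid_congruence G R"
    and "effective_group G R"
    and "card (UNIV :: 'a set) \<ge> 2" and "card (UNIV :: 'b set) \<ge> 2"
    and "subshift (quotient_monoid G R) X"
    and "subshift (quotient_monoid G R) Y"
    and "card B' \<ge> 5"
    and "\<And>a b c. a \<in> B' \<Longrightarrow> b \<in> B' \<Longrightarrow> c \<in> B' \<Longrightarrow> distinct [a, b, c] \<Longrightarrow>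
           permutable (quotient_monoid G R) (three_cycle a b c) Y"
    and letter_occurs: "\<exists>y\<in>Y. y \<one>\<^bsub>quotient_monoid G R\<^esub> \<in> B'"
    and shifts_are_automorphisms:
      "\<And>g. g \<in> G \<Longrightarrow> shift_fst (quotient_monoid G R) X Y (proj_word R [g])
           \<in> carrier (automorphism_group (quotient_monoid G R) X Y)"
  shows "one_one_reducible
           pattern_code (patterns G) (colanguage G R X)
           generator_word_code (lists (generators G B'))
           (word_problem (generated_group G R X Y B') (generators G B') (generator_map G R X Y))"
proof -
  obtain \<psi> where \<psi>: "computable_on list_encode list_encode (lists G) \<psi>"
      "\<And>w. w \<in> lists G \<Longrightarrow> \<psi> w \<in> lists G \<and>
          proj_word R (w @ \<psi> w) = \<one>\<^bsub>quotient_monoid G R\<^esub> \<and>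
          proj_word R (\<psi> w @ w) = \<one>\<^bsub>quotient_monoid G R\<^esub>"
    using assms(2) unfolding effective_group_def by blast
  obtain l where l: "distinct l" "set l = B'"
    by (meson finite finite_distinct_list)
  then have "5 \<le> length l"
    using assms(7) distinct_card[of l] by simp
  then obtain p q r s t l' where "l = p # q # r # s # t # l'"
    by (auto simp: numeral_eq_Suc Suc_le_length_iff)
  with l have pqrst: "distinct [p, q, r, s, t]" "{p, q, r, s, t} \<subseteq> B'"
    by auto
  interpret reduction G R X Y B' \<psi> p q r s t
    by unfold_locales (use assms \<psi> pqrst in \<open>blast+\<close>)
  let ?\<phi> = "\<lambda>u :: 'a pattern. reduction_word (pattern_code u)"
  have valid: "valid_code (pattern_code u)" if "u \<in> patterns G" for u :: "'a pattern"
    using cell_of_pattern[OF that] by (simp add: valid_code_def)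
  show ?thesis
    unfolding one_one_reducible_def
  proof (intro exI[of _ ?\<phi>] conjI ballI)
    show "computable_on pattern_code generator_word_code (patterns G) ?\<phi>"
      unfolding computable_on_def using computable_reduction_word[OF \<psi>(1)] valid by metis
    show "?\<phi> \<in> patterns G \<rightarrow> lists (generators G B')"
      using reduction_word_closed valid by blast
    show "inj_on ?\<phi> (patterns G)"
      using comp_inj_on[OF inj_on_pattern_code inj_on_subset[OF inj_reduction_word]]
      by (simp add: comp_def)
    show "u \<in> colanguage G R X \<longleftrightarrow> ?\<phi> u \<in>
        word_problem (generated_group G R X Y B') (generators G B') (generator_map G R X Y)"
      if "u \<in> patterns G" for u
      by (rule reduction_word_mem_word_problem[OF that letter_occurs])
  qed
qed

end
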